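(* Let $n,m\ge1$, let $\{b_{ij}:1\le i\le n,1\le j\le m\}$ be given real scalars, let $\{g_{ij}\}$ be independent $N(0,1)$ random variables, and let $X$ be the $n\times m$ random matrix with $X_{ij}=g_{ij}b_{ij}$. Define $$\sigma_1:=\max_i\sqrt{\sum_j b_{ij}^2},\quad \sigma_2:=\max_j\sqrt{\sum_i b_{ij}^2},\quad \sigma_*:=\max_{ij}|b_{ij}|.$$ Then for any $0<\varepsilon\le 1/2$, $$\mathbb{E}\|X\|\le(1+\varepsilon)\Big\{\sigma_1+\sigma_2+\frac{5}{\sqrt{\log(1+\varepsilon)}}\,\sigma_*\sqrt{\log(n\wedge m)}\Big\}.$$
   Context: $\|\cdot\|$ is the spectral norm, $\log$ the natural logarithm, $a\wedge b=\min(a,b)$. *)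

theory Defs
  imports "HOL-Probability.Probability"
begin

definition spectral_norm :: "real^'m::finite^'n::finite \<Rightarrow> real" where
  "spectral_norm A = onorm (\<lambda>y. A *v y)"

definition sigma_row :: "real^'m::finite^'n::finite \<Rightarrow> real" where
  "sigma_row b = (MAX i\<in>UNIV. sqrt (\<Sum>j\<in>UNIV. (b $ i $ j)^2))"

definition sigma_col :: "real^'m::finite^'n::finite \<Rightarrow> real" where
  "sigma_col b = (MAX j\<in>UNIV. sqrt (\<Sum>i\<in>UNIV. (b $ i $ j)^2))"

definition sigma_star :: "real^'m::finite^'n::finite \<Rightarrow> real" where
  "sigma_star b = (MAX p\<in>UNIV. \<bar>b $ fst p $ snd p\<bar>)"

end

theory Submission
  imports Defs
begin

text \<open>
  Moment method. By Wick's formula the expectation of \<open>tr ((X X\<^sup>T) ^ p)\<close> is a sum over pairings of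
  the \<open>2 p\<close> steps of a closed bipartite walk. For a fixed pairing, each walk position that is not
  identified with an earlier one is reached by a step carrying a factor \<open>b\<^sup>2\<close>, so that summing over
  its label costs at most \<open>\<sigma>\<^sub>1\<^sup>2\<close> (columns) or \<open>\<sigma>\<^sub>2\<^sup>2\<close> (rows); for a standard Gaussian matrix \<open>Y\<close> of size
  \<open>d\<^sub>1 \<times> d\<^sub>2\<close> the costs are exactly \<open>d\<^sub>2\<close> and \<open>d\<^sub>1\<close>. Hence, normalizing \<open>\<sigma>\<^sub>* = 1\<close> and rounding up the variances
  to \<open>d\<^sub>1, d\<^sub>2\<close>, the trace moment of \<open>X\<close> is at most \<open>n / d\<^sub>1\<close> times that of \<open>Y\<close>.

  By rotation invariance \<open>Y\<close> can be bidiagonalized, which turns the moments of a diagonal entry of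
  \<open>(Y Y\<^sup>T) ^ p\<close> into weighted Dyck path counts, the weights being moments of chi-square variables. These
  are at most \<open>(sqrt (d\<^sub>1 + 2 p - 1) + sqrt (d\<^sub>2 + 2 p - 1)) ^ (2 p)\<close>. Finally \<open>p\<close> is taken to be a power of
  two of order \<open>log n / log (1 + \<epsilon>)\<close>, which makes \<open>n powr (1 / (2 p))\<close> at most \<open>1 + \<epsilon>\<close>.
\<close>

section \<open>Gaussian moments\<close>

text \<open>The cost of a pairing depends only on how many row and column positions it leaves free,
  and the sum of these costs over all pairings is just what a standard Gaussian matrix computes. So
  no pairing is ever counted or classified. The obstacle is in the diagonal recursion: removing a
  row expresses a diagonal moment through products of quadratic forms of the smaller matrix, and
  these are correlated. The induction therefore concerns expectations of products, of total degree
  at most \<open>p\<close>. This cap on the degree bounds every chi-square factor by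
  \<open>d + 2 * p - 1\<close> at once. The Gaussian variables enter only through their joint
  moments, so that independence, conditioning and rotation invariance become identities between
  polynomial expectations. Taking \<open>p\<close> a power of two lets repeated Cauchy-Schwarz do
  the work of an eigenvalue decomposition. A single row is treated by its second moment, because
  there the logarithm vanishes.\<close>

definition gmoment :: "nat \<Rightarrow> real" where
  "gmoment n = (if even n then fact n / (2 ^ (n div 2) * fact (n div 2)) else 0)"

text \<open>A list with repetitions encodes a monomial; this is its expectation in independent
  standard Gaussians, a product of one-variable moments \<open>(n - 1)!!\<close> (zero for odd
  \<open>n\<close>). The sum over pairings is derived in \<open>wick_pairings\<close>.\<close>

definition wick :: "'e list \<Rightarrow> real" where
  "wick es = (\<Prod>e\<in>set es. gmoment (count_list es e))"

definition del_nth :: "nat \<Rightarrow> 'b list \<Rightarrow> 'b list" where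
  "del_nth k xs = take k xs @ drop (Suc k) xs"

lemma del_nth_0 [simp]: "del_nth 0 (x # xs) = xs"
  by (simp add: del_nth_def)

lemma del_nth_Suc [simp]: "del_nth (Suc k) (x # xs) = x # del_nth k xs"
  by (simp add: del_nth_def)

lemma length_del_nth [simp]: "k < length xs \<Longrightarrow> length (del_nth k xs) = length xs - 1"
  by (simp add: del_nth_def)

lemma map_del_nth: "map f (del_nth k xs) = del_nth k (map f xs)"
  by (simp add: del_nth_def take_map drop_map)

lemma mset_del_nth: "k < length xs \<Longrightarrow> add_mset (xs ! k) (mset (del_nth k xs)) = mset xs"
  by (metis append_take_drop_id Cons_nth_drop_Suc del_nth_def mset_append mset.simps(2) union_mset_add_mset_right)

lemma gmoment_0 [simp]: "gmoment 0 = 1"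
  by (simp add: gmoment_def)

text \<open>Gaussian integration by parts in one variable. For \<open>n = 0\<close> the truncated
  \<open>n - 1\<close> is harmless, since the factor \<open>n\<close> vanishes.\<close>

lemma gmoment_Suc: "gmoment (Suc n) = real n * gmoment (n - 1)"
proof (cases "even n")
  case True
  then show ?thesis
    by (cases n) (auto simp: gmoment_def)
next
  case False
  then obtain k where n: "n = 2 * k + 1" by (elim oddE)
  have "fact (2 * k + 2) = (2 * (real k + 1)) * ((2 * real k + 1) * fact (2 * k))"
    using fact_Suc[of "2 * k + 1", where 'a=real] fact_Suc[of "2 * k", where 'a=real]
    by (simp add: add.commute mult.assoc)
  moreover have "2 ^ (k + 1) * fact (k + 1) = (2 * (real k + 1)) * (2 ^ k * fact k)"
    by (simp add: algebra_simps)
  moreover have "2 * (real k + 1) \<noteq> 0"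
    by simp
  ultimately have "fact (2 * k + 2) / (2 ^ (k + 1) * fact (k + 1)) = (2 * real k + 1) * (fact (2 * k) / (2 ^ k * fact k))"
    by (metis mult_divide_mult_cancel_left times_divide_eq_right)
  then show ?thesis
    by (simp add: gmoment_def n del: fact_Suc power_Suc)
qed

lemma gmoment_even: "gmoment (2 * k) = 2 ^ k * pochhammer (1/2) k"
proof (induction k)
  case (Suc k)
  have "gmoment (2 * Suc k) = real (2 * k + 1) * gmoment (2 * k)"
    using gmoment_Suc[of "2 * k + 1"] by simp
  also have "\<dots> = 2 ^ Suc k * pochhammer (1/2) (Suc k)"
    by (simp only: Suc pochhammer_Suc) (simp add: algebra_simps)
  finally show ?case .
qed auto

lemma wick_superset:
  assumes "finite F" "set es \<subseteq> F"
  shows "wick es = (\<Prod>e\<in>F. gmoment (count_list es e))"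
  unfolding wick_def using assms
  by (intro prod.mono_neutral_left) (auto simp: count_list_0_iff)

lemma wick_Nil [simp]: "wick [] = 1"
  by (simp add: wick_def)

lemma count_list_del_nth:
  assumes "k < length xs"
  shows "count_list (del_nth k xs) e = count_list xs e - (if e = xs ! k then 1 else 0)"
  using arg_cong[OF mset_del_nth[OF assms], of "\<lambda>m. count m e"] by (auto simp: count_mset split: if_splits)

text \<open>Deleting any one of the \<open>count_list es a\<close> copies of \<open>a\<close> gives
  the same value, so the sum is that multiplicity times one term and \<open>gmoment_Suc\<close>
  applies. This is Wick's recursion: the first variable is paired with each later equal one.\<close>

lemma wick_Cons:
  "wick (a # es) = (\<Sum>k<length es. if es ! k = a then wick (del_nth k es) else 0)"
proof -
  define F where "F = insert a (set es)"
  have F: "finite F" "a \<in> F" "set es \<subseteq> F" by (auto simp: F_def)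
  define V where "V = (\<Prod>e\<in>F - {a}. gmoment (count_list es e))"
  have del: "wick (del_nth k es) = gmoment (count_list es a - 1) * V"
    if "k < length es" "es ! k = a" for k
  proof -
    have "set (del_nth k es) \<subseteq> F"
      using F(3) set_take_subset[of k es] set_drop_subset[of "Suc k" es] by (auto simp: del_nth_def)
    then have "wick (del_nth k es) = (\<Prod>e\<in>F. gmoment (count_list (del_nth k es) e))"
      by (rule wick_superset[OF F(1)])
    also have "\<dots> = gmoment (count_list (del_nth k es) a) * (\<Prod>e\<in>F-{a}. gmoment (count_list (del_nth k es) e))"
      using F by (simp add: prod.remove)
    also have "\<dots> = gmoment (count_list es a - 1) * V"
      unfolding V_def using that
      by (auto intro!: arg_cong2[where f="(*)"] prod.cong simp: count_list_del_nth)
    finally show ?thesis .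
  qed
  have "(\<Sum>k<length es. if es ! k = a then wick (del_nth k es) else 0)
      = (\<Sum>k\<in>{k \<in> {..<length es}. es ! k = a}. wick (del_nth k es))"
    by (subst sum.inter_filter) auto
  also have "\<dots> = real (card {k \<in> {..<length es}. es ! k = a}) * (gmoment (count_list es a - 1) * V)"
    using del by simp
  also have "card {k \<in> {..<length es}. es ! k = a} = count_list es a"
    by (simp add: count_list_eq_length_filter length_filter_conv_card eq_commute)
  also have "real (count_list es a) * (gmoment (count_list es a - 1) * V)
      = gmoment (Suc (count_list es a)) * V"
    by (simp add: gmoment_Suc)
  also have "\<dots> = (\<Prod>e\<in>F. gmoment (count_list (a # es) e))"
    using F unfolding V_def
    by (subst prod.remove[of F a]) (auto intro!: arg_cong2[where f="(*)"] prod.cong split: if_splits)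
  also have "\<dots> = wick (a # es)"
    using F by (intro wick_superset[symmetric]) auto
  finally show ?thesis by simp
qed

text \<open>Independence of the coordinates inside and outside \<open>A\<close>, in the language of
  moments; it becomes Fubini in \<open>GE_split\<close>.\<close>

lemma wick_filter:
  "wick es = wick (filter (\<lambda>e. e \<in> A) es) * wick (filter (\<lambda>e. e \<notin> A) es)"
proof -
  have c: "count_list (filter P es) e = (if P e then count_list es e else 0)" for P e
    by (induction es) auto
  have "wick es = (\<Prod>e\<in>set es. gmoment (count_list (filter (\<lambda>e. e \<in> A) es) e)
        * gmoment (count_list (filter (\<lambda>e. e \<notin> A) es) e))"
    unfolding wick_def by (intro prod.cong) (auto simp: c)
  also have "\<dots> = wick (filter (\<lambda>e. e \<in> A) es) * wick (filter (\<lambda>e. e \<notin> A) es)"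
    by (subst prod.distrib, subst (1 2) wick_superset[of "set es"]) auto
  finally show ?thesis .
qed

lemma wick_map_inj:
  assumes "inj f"
  shows "wick (map f es) = wick es"
proof -
  have c: "count_list (map f es) (f e) = count_list es e" for e
    using assms by (induction es) (auto simp: inj_eq)
  show ?thesis
    unfolding wick_def using inj_on_subset[OF assms] by (simp add: prod.reindex c)
qed

section \<open>Polynomials in Gaussian variables\<close>

text \<open>Membership serves as the certificate of integrability: everything built from the matrix
  by finite sums and products qualifies.\<close>

inductive polyf :: "(('e \<Rightarrow> real) \<Rightarrow> real) \<Rightarrow> bool" where
  polyf_const [intro, simp]: "polyf (\<lambda>x. c)"
| polyf_coord [intro, simp]: "polyf (\<lambda>x. x e)"
| polyf_add [intro]: "polyf f \<Longrightarrow> polyf h \<Longrightarrow> polyf (\<lambda>x. f x + h x)"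
| polyf_mult [intro]: "polyf f \<Longrightarrow> polyf h \<Longrightarrow> polyf (\<lambda>x. f x * h x)"

lemma polyf_sum [intro]: "(\<And>i. i \<in> I \<Longrightarrow> polyf (f i)) \<Longrightarrow> polyf (\<lambda>x. \<Sum>i\<in>I. f i x)"
  by (induction I rule: infinite_finite_induct) auto

lemma polyf_prod [intro]: "(\<And>i. i \<in> I \<Longrightarrow> polyf (f i)) \<Longrightarrow> polyf (\<lambda>x. \<Prod>i\<in>I. f i x)"
  by (induction I rule: infinite_finite_induct) auto

lemma polyf_prod_list [intro]: "(\<And>i. i \<in> set is \<Longrightarrow> polyf (f i)) \<Longrightarrow> polyf (\<lambda>x. \<Prod>i\<leftarrow>is. f i x)"
  by (induction "is") auto

lemma polyf_sum_list [intro]: "(\<And>i. i \<in> set is \<Longrightarrow> polyf (f i)) \<Longrightarrow> polyf (\<lambda>x. \<Sum>i\<leftarrow>is. f i x)"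
  by (induction "is") auto

lemma polyf_power [intro]: "polyf f \<Longrightarrow> polyf (\<lambda>x. f x ^ n)"
  by (induction n) auto

lemma polyf_if [intro]: "polyf f \<Longrightarrow> polyf h \<Longrightarrow> polyf (\<lambda>x. if P then f x else h x)"
  by (cases P) simp_all

lemmas polyf_intros = polyf_const polyf_coord polyf_add polyf_mult polyf_sum polyf_prod
  polyf_prod_list polyf_sum_list polyf_power polyf_if

lemma polyf_expand:
  assumes "polyf f"
  obtains L where "\<And>x. f x = (\<Sum>(c, es)\<leftarrow>L. c * (\<Prod>e\<leftarrow>es. x e))"
proof -
  have "\<exists>L. \<forall>x. f x = (\<Sum>(c, es)\<leftarrow>L. c * (\<Prod>e\<leftarrow>es. x e))"
    using assms
  proof induction
    case (polyf_const c)
    show ?case by (rule exI[of _ "[(c, [])]"]) simp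
  next
    case (polyf_coord e)
    show ?case by (rule exI[of _ "[(1, [e])]"]) simp
  next
    case (polyf_add f h)
    then obtain L L' where "\<forall>x. f x = (\<Sum>(c, es)\<leftarrow>L. c * (\<Prod>e\<leftarrow>es. x e))"
      "\<forall>x. h x = (\<Sum>(c, es)\<leftarrow>L'. c * (\<Prod>e\<leftarrow>es. x e))" by blast
    then show ?case by (intro exI[of _ "L @ L'"]) simp
  next
    case (polyf_mult f h)
    then obtain L L' where L: "\<forall>x. f x = (\<Sum>(c, es)\<leftarrow>L. c * (\<Prod>e\<leftarrow>es. x e))"
      "\<forall>x. h x = (\<Sum>(c, es)\<leftarrow>L'. c * (\<Prod>e\<leftarrow>es. x e))" by blast
    have 1: "(\<Sum>(c, es)\<leftarrow>map (\<lambda>(c', es'). (c * c', es @ es')) L'. c * (\<Prod>e\<leftarrow>es. x e))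
        = c * (\<Prod>e\<leftarrow>es. x e) * (\<Sum>(c, es)\<leftarrow>L'. c * (\<Prod>e\<leftarrow>es. x e))" for c es and x :: "_ \<Rightarrow> real"
      by (induction L') (auto simp: algebra_simps)
    have "(\<Sum>(c, es)\<leftarrow>concat (map (\<lambda>(c, es). map (\<lambda>(c', es'). (c * c', es @ es')) L') L). c * (\<Prod>e\<leftarrow>es. x e))
        = (\<Sum>(c, es)\<leftarrow>L. c * (\<Prod>e\<leftarrow>es. x e)) * (\<Sum>(c, es)\<leftarrow>L'. c * (\<Prod>e\<leftarrow>es. x e))" for x :: "_ \<Rightarrow> real"
    proof (induction L)
      case (Cons a L)
      then show ?case by (cases a) (simp only: list.map concat.simps map_append sum_list_append
         prod.case 1 sum_list.Cons distrib_right)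
    qed auto
    then have "\<forall>x. f x * h x = (\<Sum>(c, es)\<leftarrow>concat (map (\<lambda>(c, es). map (\<lambda>(c', es'). (c * c', es @ es')) L') L). c * (\<Prod>e\<leftarrow>es. x e))"
      using L by presburger
    then show ?case by (rule exI)
  qed
  then show ?thesis using that by blast
qed

text \<open>Only the joint moments are kept. They determine the expectation of every polynomial, so
  the arguments below are algebraic; independence and the density are consumed once, in
  \<open>gauss_familyI\<close>.\<close>

locale gauss_family = prob_space M for M :: "'a measure" +
  fixes g :: "'e \<Rightarrow> 'a \<Rightarrow> real"
  assumes moments: "has_bochner_integral M (\<lambda>\<omega>. \<Prod>e\<leftarrow>es. g e \<omega>) (wick es)"
begin

definition GE :: "(('e \<Rightarrow> real) \<Rightarrow> real) \<Rightarrow> real" where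
  "GE f = (\<integral>\<omega>. f (\<lambda>e. g e \<omega>) \<partial>M)"

lemma integrable_monomial: "integrable M (\<lambda>\<omega>. \<Prod>e\<leftarrow>es. g e \<omega>)"
  using moments by (rule integrable.intros)

lemma GE_monomial: "GE (\<lambda>x. \<Prod>e\<leftarrow>es. x e) = wick es"
  unfolding GE_def using moments by (rule has_bochner_integral_integral_eq)

lemma integrable_polyf:
  assumes "polyf f"
  shows "integrable M (\<lambda>\<omega>. f (\<lambda>e. g e \<omega>))"
proof -
  obtain L where L: "\<And>x. f x = (\<Sum>(c, es)\<leftarrow>L. c * (\<Prod>e\<leftarrow>es. x e))"
    using polyf_expand[OF assms] by blast
  have "integrable M (\<lambda>\<omega>. \<Sum>(c, es)\<leftarrow>L. c * (\<Prod>e\<leftarrow>es. g e \<omega>))"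
    by (induction L) (auto simp: case_prod_beta intro!: integrable_monomial)
  then show ?thesis by (simp add: L)
qed

lemma GE_const [simp]: "GE (\<lambda>x. c) = c"
  by (simp add: GE_def prob_space)

lemma GE_add: "polyf f \<Longrightarrow> polyf h \<Longrightarrow> GE (\<lambda>x. f x + h x) = GE f + GE h"
  unfolding GE_def by (intro Bochner_Integration.integral_add integrable_polyf)

lemma GE_cmult: "GE (\<lambda>x. c * f x) = c * GE f"
  by (simp add: GE_def)

lemma GE_multc: "GE (\<lambda>x. f x * c) = GE f * c"
  by (simp add: GE_def)

lemma GE_sum: "(\<And>i. i \<in> I \<Longrightarrow> polyf (f i)) \<Longrightarrow> GE (\<lambda>x. \<Sum>i\<in>I. f i x) = (\<Sum>i\<in>I. GE (f i))"
  unfolding GE_def by (intro Bochner_Integration.integral_sum integrable_polyf)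

lemma GE_expand:
  assumes "\<And>x. f x = (\<Sum>(c, es)\<leftarrow>L. c * h x es)" "\<And>es. polyf (\<lambda>x. h x es)"
  shows "GE f = (\<Sum>(c, es)\<leftarrow>L. c * GE (\<lambda>x. h x es))"
proof -
  have "GE (\<lambda>x. \<Sum>(c, es)\<leftarrow>L. c * h x es) = (\<Sum>(c, es)\<leftarrow>L. c * GE (\<lambda>x. h x es))"
  proof (induction L)
    case (Cons a L)
    have "polyf (\<lambda>x. \<Sum>p\<leftarrow>L. fst p * h x (snd p))"
      using assms(2) by (intro polyf_sum_list polyf_mult) auto
    with Cons assms(2) show ?case
      by (simp add: case_prod_beta GE_add polyf_mult GE_cmult)
  qed auto
  then show ?thesis using assms(1) by presburger
qed

text \<open>Fubini with an independent copy: nesting two expectations over the same family makes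
  \<open>x\<close> and \<open>y\<close> independent. On monomials this is
  \<open>wick_filter\<close>, the rest is linearity.\<close>

lemma GE_split:
  assumes "polyf f"
  shows "GE f = GE (\<lambda>x. GE (\<lambda>y. f (\<lambda>e. if e \<in> A then x e else y e)))"
proof -
  obtain L where L: "\<And>x. f x = (\<Sum>(c, es)\<leftarrow>L. c * (\<Prod>e\<leftarrow>es. x e))"
    using polyf_expand[OF assms] by blast
  have split: "(\<Prod>e\<leftarrow>es. if e \<in> A then x e else y e)
      = (\<Prod>e\<leftarrow>filter (\<lambda>e. e \<in> A) es. x e) * (\<Prod>e\<leftarrow>filter (\<lambda>e. e \<notin> A) es. y e)" for x y :: "'e \<Rightarrow> real" and es
    by (induction es) auto
  have "GE (\<lambda>y. f (\<lambda>e. if e \<in> A then x e else y e))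
      = (\<Sum>(c, es)\<leftarrow>L. c * ((\<Prod>e\<leftarrow>filter (\<lambda>e. e \<in> A) es. x e) * wick (filter (\<lambda>e. e \<notin> A) es)))" for x
    by (subst GE_expand[where L=L and h="\<lambda>y es. \<Prod>e\<leftarrow>es. if e \<in> A then x e else y e"])
       (auto simp: L GE_cmult GE_monomial split[symmetric] intro!: polyf_prod_list, simp add: split GE_cmult GE_monomial)
  then have "GE (\<lambda>x. GE (\<lambda>y. f (\<lambda>e. if e \<in> A then x e else y e)))
      = (\<Sum>(c, es)\<leftarrow>L. c * GE (\<lambda>x. (\<Prod>e\<leftarrow>filter (\<lambda>e. e \<in> A) es. x e) * wick (filter (\<lambda>e. e \<notin> A) es)))"
    by (intro GE_expand polyf_intros)
  also have "\<dots> = (\<Sum>(c, es)\<leftarrow>L. c * wick es)"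
    by (simp add: GE_multc GE_monomial wick_filter[of _ A, symmetric])
  also have "\<dots> = GE f"
    by (subst GE_expand[where L=L, OF L]) (auto simp: GE_monomial)
  finally show ?thesis by simp
qed

text \<open>Chi-square moments with \<open>card A\<close> degrees of freedom. Splitting off one
  coordinate and expanding binomially leaves the Vandermonde identity for rising factorials.\<close>

lemma GE_power_sum_squares:
  assumes "finite A"
  shows "GE (\<lambda>x. (\<Sum>e\<in>A. (x e)\<^sup>2) ^ s) = 2 ^ s * pochhammer (real (card A) / 2) s"
  using assms
proof (induction A arbitrary: s)
  case empty
  then show ?case by (cases s) (auto simp: pochhammer_rec)
next
  case (insert a A)
  have "GE (\<lambda>x. (\<Sum>e\<in>insert a A. (x e)\<^sup>2) ^ s)
      = GE (\<lambda>x. GE (\<lambda>y. ((x a)\<^sup>2 + (\<Sum>e\<in>A. (y e)\<^sup>2)) ^ s))"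
  proof (subst GE_split[of _ "{a}"])
    have "(\<Sum>e\<in>A. (if e \<in> {a} then x e else y e)\<^sup>2) = (\<Sum>e\<in>A. (y e)\<^sup>2)" for x y :: "'e \<Rightarrow> real"
      using insert by (intro sum.cong) auto
    then show "GE (\<lambda>x. GE (\<lambda>y. (\<Sum>e\<in>insert a A. (if e \<in> {a} then x e else y e)\<^sup>2) ^ s))
        = GE (\<lambda>x. GE (\<lambda>y. ((x a)\<^sup>2 + (\<Sum>e\<in>A. (y e)\<^sup>2)) ^ s))"
      using insert by simp
  qed (intro polyf_intros)
  also have "\<dots> = GE (\<lambda>x. GE (\<lambda>y. \<Sum>k\<le>s. real (s choose k) * (x a) ^ (2 * k) * (\<Sum>e\<in>A. (y e)\<^sup>2) ^ (s - k)))"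
    by (simp add: binomial_ring power_mult)
  also have "\<dots> = GE (\<lambda>x. \<Sum>k\<le>s. real (s choose k) * (x a) ^ (2 * k) * (2 ^ (s - k) * pochhammer (real (card A) / 2) (s - k)))"
    by (subst GE_sum, intro polyf_intros) (simp add: GE_cmult insert.IH)
  also have "\<dots> = (\<Sum>k\<le>s. real (s choose k) * gmoment (2 * k) * (2 ^ (s - k) * pochhammer (real (card A) / 2) (s - k)))"
  proof -
    have "count_list (replicate n a) a = n" for n
      by (induction n) auto
    then have "GE (\<lambda>x. x a ^ n) = gmoment n" for n
      using GE_monomial[of "replicate n a"]
      by (cases "n = 0") (auto simp: wick_def set_replicate_conv_if)
    then show ?thesis by (subst GE_sum, intro polyf_intros) (simp add: GE_cmult GE_multc)
  qed
  also have "\<dots> = (\<Sum>k\<le>s. 2 ^ s * (real (s choose k) * pochhammer (1/2) k * pochhammer (real (card A) / 2) (s - k)))"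
    by (intro sum.cong refl) (auto simp: gmoment_even power_add dest!: le_Suc_ex)
  also have "\<dots> = 2 ^ s * pochhammer (1/2 + real (card A) / 2) s"
    by (simp add: pochhammer_binomial_sum sum_distrib_left)
  finally show ?case using insert by (simp add: add_divide_distrib)
qed

text \<open>The moment is the product of \<open>card A + 2 * i\<close> over \<open>i < s\<close>,
  where \<open>i\<close> is at most \<open>p - 1\<close>. The choice \<open>2 * p - 1\<close> keeps
  the bound positive for empty \<open>A\<close> and \<open>p \<ge> 1\<close>, while its
  \<open>- 1\<close> later absorbs the rounding of the variances.\<close>

lemma GE_power_sum_squares_le:
  assumes "finite A" "s \<le> p"
  shows "GE (\<lambda>x. (\<Sum>e\<in>A. (x e)\<^sup>2) ^ s) \<le> (real (card A) + (2 * real p - 1)) ^ s"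
proof -
  have "2 ^ s * pochhammer (real (card A) / 2) s = (\<Prod>i<s. real (card A) + 2 * real i)"
    by (induction s) (auto simp: pochhammer_Suc algebra_simps)
  also have "\<dots> \<le> (\<Prod>i<s. real (card A) + (2 * real p - 1))"
    using assms by (intro prod_mono) auto
  finally show ?thesis using assms by (simp add: GE_power_sum_squares)
qed

end

locale finite_gauss_family = gauss_family M g
  for M :: "'a measure" and g :: "'e::finite \<Rightarrow> 'a \<Rightarrow> real"
begin

text \<open>Gaussian integration by parts gives the linear forms \<open>L\<close> below the same moment recursion as the coordinates.\<close>

lemma GE_rotate_monomial:
  fixes h :: "'e \<Rightarrow> 'e \<Rightarrow> real"
  assumes h: "\<And>e e'. (\<Sum>f\<in>UNIV. h e f * h e' f) = (if e = e' then 1 else 0)"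
  shows "GE (\<lambda>x. \<Prod>e\<leftarrow>es. \<Sum>f\<in>UNIV. h e f * x f) = wick es"
proof -
  define L where "L e x = (\<Sum>f\<in>UNIV. h e f * x f)" for e and x :: "'e \<Rightarrow> real"
  \<comment> \<open>Coordinates and rotated forms are mixed because the recursion turns forms into
    coordinates one at a time.\<close>
  define G where "G fs es = GE (\<lambda>x. (\<Prod>f\<leftarrow>fs. x f) * (\<Prod>e\<leftarrow>es. L e x))" for fs es
  have pL [simp, intro]: "polyf (L e)" for e
    unfolding L_def by (intro polyf_sum polyf_mult) auto
  have G_Cons: "G fs (e # es) = (\<Sum>f\<in>UNIV. h e f * G (f # fs) es)" for fs e es
  proof -
    have "G fs (e # es) = GE (\<lambda>x. \<Sum>f\<in>UNIV. h e f * ((\<Prod>f\<leftarrow>f # fs. x f) * (\<Prod>e\<leftarrow>es. L e x)))"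
      unfolding G_def list.map prod_list.Cons L_def[of e] by (simp add: sum_distrib_left sum_distrib_right ac_simps)
    also have "\<dots> = (\<Sum>f\<in>UNIV. h e f * G (f # fs) es)"
      unfolding G_def
      by (subst GE_sum) (auto intro!: polyf_mult polyf_prod_list simp: GE_cmult)
    finally show ?thesis .
  qed
  have G_comm: "G (a # b # fs) es = G (b # a # fs) es" for a b fs es
    by (simp add: G_def ac_simps)
  \<comment> \<open>Integration by parts: \<open>x a\<close> is contracted either with an equal
    coordinate or with a form, whose covariance with it is \<open>h (es ! k) a\<close>.\<close>
  have stein: "G (a # fs) es = (\<Sum>k<length fs. if fs ! k = a then G (del_nth k fs) es else 0)
      + (\<Sum>k<length es. h (es ! k) a * G fs (del_nth k es))" for a fs es
  proof (induction es arbitrary: fs)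
    case Nil
    show ?case using GE_monomial[of "a # fs"]
      by (simp add: G_def GE_monomial wick_Cons cong: if_cong)
  next
    case (Cons e es)
    have "G (a # fs) (e # es) = (\<Sum>f\<in>UNIV. h e f * G (a # f # fs) es)"
      by (simp add: G_Cons G_comm)
    also have "\<dots> = (\<Sum>f\<in>UNIV. (if f = a then h e f * G fs es else 0)
       + ((\<Sum>k<length fs. if fs ! k = a then h e f * G (f # del_nth k fs) es else 0)
       + (\<Sum>k<length es. h (es ! k) a * (h e f * G (f # fs) (del_nth k es)))))"
      by (intro sum.cong refl)
         (subst Cons, simp only: length_Cons sum.lessThan_Suc_shift nth_Cons_0 nth_Cons_Suc del_nth_0 del_nth_Suc,
          simp add: distrib_left sum_distrib_left if_distrib mult.left_commute cong: if_cong)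
    also have "\<dots> = h e a * G fs es
       + ((\<Sum>k<length fs. \<Sum>f\<in>UNIV. if fs ! k = a then h e f * G (f # del_nth k fs) es else 0)
       + (\<Sum>k<length es. h (es ! k) a * (\<Sum>f\<in>UNIV. h e f * G (f # fs) (del_nth k es))))"
      unfolding sum.distrib sum_distrib_left
      by (intro arg_cong2[where f="(+)"] sum.swap) simp
    also have "\<dots> = h e a * G fs es
       + ((\<Sum>k<length fs. if fs ! k = a then G (del_nth k fs) (e # es) else 0)
       + (\<Sum>k<length es. h (es ! k) a * G fs (e # del_nth k es)))"
      by (intro arg_cong2[where f="(+)"] refl sum.cong) (auto simp: G_Cons)
    also have "\<dots> = (\<Sum>k<length fs. if fs ! k = a then G (del_nth k fs) (e # es) else 0)
      + (\<Sum>k<length (e # es). h ((e # es) ! k) a * G fs (del_nth k (e # es)))"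
      by (simp only: length_Cons sum.lessThan_Suc_shift) simp
    finally show ?case .
  qed
  have "G [] es = wick es"
  proof (induction es rule: length_induct)
    case (1 es)
    show ?case
    proof (cases es)
      case Nil
      then show ?thesis by (simp add: G_def)
    next
      case (Cons e es')
      define n where "n = length es'"
      have es: "es = e # es'" "length es' = n" using Cons by (auto simp: n_def)
    have "G [] es = (\<Sum>f\<in>UNIV. \<Sum>k<n. (h e f * h (es' ! k) f) * G [] (del_nth k es'))"
      unfolding es(1) G_Cons stein by (simp add: es(2) sum_distrib_left ac_simps)
    \<comment> \<open>Two forms contract to the inner product of their rows, which is 0 or 1 by
      orthonormality; what remains is the recursion \<open>wick_Cons\<close>.\<close>
    also have "\<dots> = (\<Sum>k<n. (\<Sum>f\<in>UNIV. h e f * h (es' ! k) f) * G [] (del_nth k es'))"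
      by (subst sum.swap) (simp add: sum_distrib_right)
    also have "\<dots> = (\<Sum>k<n. if es' ! k = e then wick (del_nth k es') else 0)"
      using es 1 by (intro sum.cong refl) (simp add: h)
    also have "\<dots> = wick es" by (simp add: es wick_Cons)
      finally show ?thesis .
    qed
  qed
  then show ?thesis by (simp add: G_def L_def)
qed

lemma GE_rotate:
  fixes h :: "'e \<Rightarrow> 'e \<Rightarrow> real"
  assumes h: "\<And>e e'. (\<Sum>f\<in>UNIV. h e f * h e' f) = (if e = e' then 1 else 0)"
    and F: "polyf F"
  shows "GE (\<lambda>x. F (\<lambda>e. \<Sum>f\<in>UNIV. h e f * x f)) = GE F"
proof -
  obtain L where L: "\<And>x. F x = (\<Sum>(c, es)\<leftarrow>L. c * (\<Prod>e\<leftarrow>es. x e))"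
    using polyf_expand[OF F] by blast
  have "GE (\<lambda>x. F (\<lambda>e. \<Sum>f\<in>UNIV. h e f * x f))
      = (\<Sum>(c, es)\<leftarrow>L. c * GE (\<lambda>x. \<Prod>e\<leftarrow>es. \<Sum>f\<in>UNIV. h e f * x f))"
    by (rule GE_expand) (auto simp: L intro!: polyf_prod_list polyf_sum polyf_mult)
  also have "\<dots> = (\<Sum>(c, es)\<leftarrow>L. c * wick es)"
    by (simp add: GE_rotate_monomial[OF h])
  also have "\<dots> = GE F"
    by (subst GE_expand[where L=L, OF L]) (auto simp: GE_monomial)
  finally show ?thesis .
qed

end

section \<open>Obtaining Gaussian families: reindexing and independent variables\<close>

lemma gauss_family_reindex:
  assumes "gauss_family M g" "inj f"
  shows "gauss_family M (\<lambda>e. g (f e))"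
proof -
  interpret gauss_family M g by fact
  show ?thesis
    by unfold_locales (use moments[of "map f es" for es] in \<open>simp add: comp_def wick_map_inj[OF assms(2)]\<close>)
qed

lemma gauss_familyI:
  fixes g :: "'e::finite \<Rightarrow> 'a \<Rightarrow> real"
  assumes "prob_space M" and ind: "prob_space.indep_vars M (\<lambda>_. borel) g UNIV"
    and dist: "\<And>e. distributed M lborel (g e) std_normal_density"
  shows "gauss_family M g"
proof -
  interpret prob_space M by fact
  have mom: "integrable M (\<lambda>\<omega>. g e \<omega> ^ n)" "(\<integral>\<omega>. g e \<omega> ^ n \<partial>M) = gmoment n" for e n
  proof -
    show "integrable M (\<lambda>\<omega>. g e \<omega> ^ n)"
      using distributed_integrable[OF dist[of e], of "\<lambda>x. x ^ n"] integrable_std_normal_moment[of n] by simp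
    have "(\<integral>\<omega>. g e \<omega> ^ n \<partial>M) = (\<integral>x. std_normal_density x * x ^ n \<partial>lborel)"
      using distributed_integral[OF dist[of e], of "\<lambda>x. x ^ n"] by simp
    also have "\<dots> = gmoment n"
    proof (cases "even n")
      case True
      then show ?thesis by (elim evenE) (simp add: integral_std_normal_moment_even gmoment_def)
    next
      case False
      then show ?thesis by (elim oddE) (simp only: integral_std_normal_moment_odd, simp add: gmoment_def)
    qed
    finally show "(\<integral>\<omega>. g e \<omega> ^ n \<partial>M) = gmoment n" .
  qed
  have prod: "(\<Prod>e\<leftarrow>es. x e) = (\<Prod>e\<in>UNIV. x e ^ count_list es e)" for es and x :: "'e \<Rightarrow> real"
  proof (induction es)
    case (Cons a es)
    have "(\<Prod>e\<in>UNIV. x e ^ count_list (a # es) e) = (\<Prod>e\<in>UNIV. (if e = a then x e else 1) * x e ^ count_list es e)"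
      by (intro prod.cong) auto
    also have "\<dots> = x a * (\<Prod>e\<in>UNIV. x e ^ count_list es e)"
      by (simp add: prod.distrib)
    finally show ?case using Cons by simp
  qed auto
  have ind': "indep_vars (\<lambda>_. borel) (\<lambda>e \<omega>. g e \<omega> ^ n e) UNIV" for n
    using indep_vars_compose2[OF ind, of "\<lambda>e x. x ^ n e" "\<lambda>_. borel"] by simp
  show ?thesis
  proof unfold_locales
    fix es :: "'e list"
    have "integrable M (\<lambda>\<omega>. \<Prod>e\<leftarrow>es. g e \<omega>)"
      unfolding prod by (intro indep_vars_integrable ind' mom) auto
    moreover have "(\<integral>\<omega>. (\<Prod>e\<leftarrow>es. g e \<omega>) \<partial>M) = wick es"
      unfolding prod using wick_superset[of UNIV es]
      by (subst indep_vars_lebesgue_integral[OF _ ind' mom(1)]) (auto simp: mom)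
    ultimately show "has_bochner_integral M (\<lambda>\<omega>. \<Prod>e\<leftarrow>es. g e \<omega>) (wick es)"
      by (simp add: has_bochner_integral_iff)
  qed
qed

section \<open>First-passage recursions\<close>

text \<open>Coefficients of \<open>1 / (1 - z Q(z))\<close>, where \<open>Q\<close> is the
  generating function of \<open>q\<close>.\<close>

fun renewal :: "(nat \<Rightarrow> real) \<Rightarrow> nat \<Rightarrow> real" where
  "renewal q 0 = 1"
| "renewal q (Suc k) = (\<Sum>j\<le>k. q j * renewal q (k - j))"

text \<open>\<open>dyck A B k\<close> counts Dyck paths of length \<open>2 * k\<close>, with weight \<open>A\<close> for an up-step from an even
  level and \<open>B\<close> for an up-step from an odd level.\<close>

fun dyck :: "real \<Rightarrow> real \<Rightarrow> nat \<Rightarrow> real" where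
  "dyck A B 0 = 1"
| "dyck A B (Suc k) = A * (\<Sum>j\<le>k. dyck B A j * dyck A B (k - j))"

text \<open>First-return decomposition: an excursion is an up-step of weight \<open>A\<close>
  followed by a Dyck path one level higher, where the two weights are swapped.\<close>

lemma renewal_dyck: "renewal (\<lambda>j. A * dyck B A j) k = dyck A B k"
proof (induction k rule: less_induct)
  case (less k)
  then show ?case by (cases k) (auto simp: sum_distrib_left mult.assoc)
qed

lemma dyck_nonneg: "0 \<le> A \<Longrightarrow> 0 \<le> B \<Longrightarrow> 0 \<le> dyck A B k"
proof (induction k arbitrary: A B rule: less_induct)
  case (less k)
  then show ?case by (cases k) (auto intro!: mult_nonneg_nonneg sum_nonneg)
qed

lemma dyck_mono:
  "0 \<le> A \<Longrightarrow> 0 \<le> B \<Longrightarrow> A \<le> A' \<Longrightarrow> B \<le> B' \<Longrightarrow> dyck A B k \<le> dyck A' B' k"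
proof (induction k arbitrary: A B A' B' rule: less_induct)
  case (less k)
  then show ?case
    by (cases k) (auto intro!: mult_mono sum_mono mult_nonneg_nonneg sum_nonneg dyck_nonneg)
qed

text \<open>Concatenating two Dyck paths gives a Dyck path. In the recursion, the product only
  reaches the terms \<open>j \<le> m\<close> of the sum for \<open>m + l\<close>.\<close>

lemma dyck_supermult:
  assumes "0 \<le> A" "0 \<le> B"
  shows "dyck A B k * dyck A B l \<le> dyck A B (k + l)"
proof (induction k rule: less_induct)
  case (less k)
  show ?case
  proof (cases k)
    case (Suc m)
    have "dyck A B k * dyck A B l = A * (\<Sum>j\<le>m. dyck B A j * (dyck A B (m - j) * dyck A B l))"
      by (simp add: Suc sum_distrib_right sum_distrib_left ac_simps)
    also have "\<dots> \<le> A * (\<Sum>j\<le>m. dyck B A j * dyck A B (m - j + l))"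
      by (intro mult_left_mono sum_mono dyck_nonneg less) (use assms Suc in auto)
    also have "\<dots> \<le> A * (\<Sum>j\<le>m + l. dyck B A j * dyck A B (m + l - j))"
    proof (intro mult_left_mono)
      have "(\<Sum>j\<le>m. dyck B A j * dyck A B (m - j + l)) = (\<Sum>j\<le>m. dyck B A j * dyck A B (m + l - j))"
        by (intro sum.cong) auto
      also have "\<dots> \<le> (\<Sum>j\<le>m + l. dyck B A j * dyck A B (m + l - j))"
        using assms by (intro sum_mono2 mult_nonneg_nonneg dyck_nonneg) auto
      finally show "(\<Sum>j\<le>m. dyck B A j * dyck A B (m - j + l))
        \<le> (\<Sum>j\<le>m + l. dyck B A j * dyck A B (m + l - j))" .
    qed (use assms in auto)
    finally show ?thesis by (simp add: Suc)
  qed auto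
qed

lemma dyck_power_le:
  assumes "0 \<le> A" "0 \<le> B"
  shows "dyck A B k ^ N \<le> dyck A B (k * N)"
proof (induction N)
  case (Suc N)
  have "dyck A B k ^ Suc N \<le> dyck A B k * dyck A B (k * N)"
    using Suc assms by (auto intro!: mult_left_mono dyck_nonneg)
  also have "\<dots> \<le> dyck A B (k * Suc N)"
    using dyck_supermult[OF assms, of k "k * N"] by simp
  finally show ?case .
qed auto

text \<open>The generating functions of \<open>dyck A B\<close> and \<open>dyck B A\<close> at the critical point
  \<open>1 / (a + b)\<^sup>2\<close>, \<open>a = sqrt A\<close>, \<open>b = sqrt B\<close>, are \<open>1 + a / b\<close> and \<open>1 + b / a\<close>.\<close>

lemma dyck_generating_le:
  assumes "0 < a" "0 < b"
  shows "(\<Sum>k\<le>N. dyck (a\<^sup>2) (b\<^sup>2) k / (a + b) ^ (2 * k)) \<le> 1 + a / b"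
  using assms
proof (induction N arbitrary: a b)
  case (Suc N)
  define z where "z = 1 / (a + b)\<^sup>2"
  have z: "x / (a + b) ^ (2 * k) = x * z ^ k" for x k
    by (simp add: z_def power_mult power_one_over)
  have z0: "z \<ge> 0" by (simp add: z_def)
  define c where "c k = dyck (a\<^sup>2) (b\<^sup>2) k * z ^ k" for k
  define c' where "c' k = dyck (b\<^sup>2) (a\<^sup>2) k * z ^ k" for k
  have c0: "c k \<ge> 0" "c' k \<ge> 0" for k
    using z0 by (auto simp: c_def c'_def intro!: mult_nonneg_nonneg dyck_nonneg)
  have c_Suc: "c (Suc k) = a\<^sup>2 * z * (\<Sum>j\<le>k. c' j * c (k - j))" for k
  proof -
    have "c (Suc k) = a\<^sup>2 * z * (\<Sum>j\<le>k. dyck (b\<^sup>2) (a\<^sup>2) j * dyck (a\<^sup>2) (b\<^sup>2) (k - j) * z ^ k)"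
      by (simp add: c_def sum_distrib_right sum_distrib_left ac_simps)
    also have "(\<Sum>j\<le>k. dyck (b\<^sup>2) (a\<^sup>2) j * dyck (a\<^sup>2) (b\<^sup>2) (k - j) * z ^ k) = (\<Sum>j\<le>k. c' j * c (k - j))"
      by (intro sum.cong refl) (auto simp: c_def c'_def power_add dest!: le_Suc_ex)
    finally show ?thesis .
  qed
  have IH: "(\<Sum>k\<le>N. c k) \<le> 1 + a / b" "(\<Sum>k\<le>N. c' k) \<le> 1 + b / a"
    using Suc.IH[of a b] Suc.IH[of b a] Suc.prems by (simp_all add: z c_def c'_def add.commute[of b a])
  have "(\<Sum>k\<le>Suc N. c k) = 1 + (\<Sum>k\<le>N. c (Suc k))"
    by (subst sum.atMost_Suc_shift) (simp add: c_def)
  also have "(\<Sum>k\<le>N. c (Suc k)) = a\<^sup>2 * z * (\<Sum>k\<le>N. \<Sum>j\<le>k. c' j * c (k - j))"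
    by (simp add: c_Suc sum_distrib_left)
  also have "(\<Sum>k\<le>N. \<Sum>j\<le>k. c' j * c (k - j)) = (\<Sum>(i, j)\<in>{(i, j). i + j \<le> N}. c' i * c j)"
    by (rule sum.triangle_reindex_eq[symmetric])
  \<comment> \<open>Enlarging the triangle to a square turns the Cauchy product into a product of
    two partial sums, one for each order of the weights, both covered by the induction
    hypothesis.\<close>
  also have "\<dots> \<le> (\<Sum>(i, j)\<in>{..N} \<times> {..N}. c' i * c j)"
    using c0 by (intro sum_mono2) auto
  also have "\<dots> = (\<Sum>i\<le>N. c' i) * (\<Sum>j\<le>N. c j)"
    by (simp add: sum_product sum.cartesian_product)
  also have "\<dots> \<le> (1 + b / a) * (1 + a / b)"
    using IH c0 Suc.prems by (intro mult_mono) (auto intro!: sum_nonneg add_nonneg_nonneg)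
  finally have "(\<Sum>k\<le>Suc N. c k) \<le> 1 + a\<^sup>2 * z * ((1 + b / a) * (1 + a / b))"
    using z0 by (simp add: mult_left_mono)
  \<comment> \<open>At the critical \<open>z\<close> the claimed bounds are a fixed point of the
    recursion, so the induction closes without loss.\<close>
  also have "\<dots> = 1 + a / b"
  proof -
    have "(1 + b / a) * (1 + a / b) = (a + b)\<^sup>2 / (a * b)"
      using Suc.prems by (simp add: field_simps power2_eq_square)
    then show ?thesis
      using Suc.prems by (simp add: z_def power2_eq_square)
  qed
  finally show ?case by (simp only: z c_def)
qed simp

text \<open>Tensor-power trick: a ratio \<open>t > 1\<close> would, by supermultiplicativity, make
  single terms of the generating sum at least \<open>t ^ N\<close>, against the uniform bound on its
  partial sums. So no constant factor is lost.\<close>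

lemma dyck_squares_le:
  assumes ab: "0 < a" "0 < b"
  shows "dyck (a\<^sup>2) (b\<^sup>2) k \<le> (a + b) ^ (2 * k)"
proof (rule ccontr)
  define t where "t = dyck (a\<^sup>2) (b\<^sup>2) k / (a + b) ^ (2 * k)"
  assume "\<not> ?thesis"
  then have "t > 1" using ab by (simp add: t_def)
  then obtain N where N: "1 + a / b < t ^ N" using real_arch_pow by blast
  have "t ^ N \<le> dyck (a\<^sup>2) (b\<^sup>2) (k * N) / (a + b) ^ (2 * (k * N))"
    using dyck_power_le[of "a\<^sup>2" "b\<^sup>2" k N] ab
    by (simp add: t_def power_divide power_mult[symmetric] mult.assoc divide_right_mono)
  also have "\<dots> \<le> (\<Sum>k\<le>k * N. dyck (a\<^sup>2) (b\<^sup>2) k / (a + b) ^ (2 * k))"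
    using ab by (intro member_le_sum[where f="\<lambda>k. dyck (a\<^sup>2) (b\<^sup>2) k / (a + b) ^ (2 * k)"])
      (auto intro!: divide_nonneg_nonneg dyck_nonneg)
  also have "\<dots> \<le> 1 + a / b"
    by (rule dyck_generating_le[OF ab])
  finally show False using N by simp
qed

lemma dyck_le: "0 < A \<Longrightarrow> 0 < B \<Longrightarrow> dyck A B k \<le> (sqrt A + sqrt B) ^ (2 * k)"
  using dyck_squares_le[of "sqrt A" "sqrt B" k] by simp

text \<open>Expansion according to the last use of the rank-one term: before it the full operator
  acts \<open>m - 1 - j\<close> times, after it only \<open>N'\<close> acts, \<open>j\<close>
  times.\<close>

lemma rank_one_power:
  fixes N N' :: "'b::real_inner \<Rightarrow> 'b"
  assumes "linear N'" and N: "\<And>v. N v = N' v + (y \<bullet> v) *\<^sub>R y"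
  shows "(N ^^ m) y = (N' ^^ m) y + (\<Sum>j<m. (y \<bullet> (N ^^ (m - 1 - j)) y) *\<^sub>R (N' ^^ j) y)"
proof (induction m)
  case (Suc m)
  have "(N ^^ Suc m) y = N' ((N ^^ m) y) + (y \<bullet> (N ^^ m) y) *\<^sub>R y"
    by (simp add: N)
  also have "N' ((N ^^ m) y) = (N' ^^ Suc m) y + (\<Sum>j<m. (y \<bullet> (N ^^ (m - Suc j)) y) *\<^sub>R (N' ^^ Suc j) y)"
    by (subst Suc) (simp add: linear_add[OF assms(1)] linear_sum[OF assms(1)] linear_cmul[OF assms(1)] del: funpow.simps(2) add: funpow.simps(2)[of _ N'] )
  finally show ?case
    by (simp add: sum.lessThan_Suc_shift del: sum.lessThan_Suc)
qed simp

text \<open>Coefficientwise Sherman-Morrison formula. The convention \<open>t 0 = 1\<close> gives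
  the term without any rank-one factor the same shape as the others.\<close>

lemma rank_one_renewal:
  fixes N N' :: "'b::real_inner \<Rightarrow> 'b"
  assumes "linear N'" and N: "\<And>v. N v = N' v + (y \<bullet> v) *\<^sub>R y"
    and "t 0 = 1" and t: "\<And>k. t (Suc k) = y \<bullet> (N ^^ k) y"
  shows "t k = renewal (\<lambda>j. y \<bullet> (N' ^^ j) y) k"
proof (induction k rule: less_induct)
  case (less k)
  show ?case
  proof (cases k)
    case (Suc m)
    have "t k = y \<bullet> (N' ^^ m) y + (\<Sum>j<m. (y \<bullet> (N ^^ (m - 1 - j)) y) * (y \<bullet> (N' ^^ j) y))"
      unfolding Suc t by (subst rank_one_power[OF assms(1,2)]) (simp add: inner_add_right inner_sum_right)
    also have "\<dots> = (\<Sum>j<m. (y \<bullet> (N' ^^ j) y) * t (m - j)) + (y \<bullet> (N' ^^ m) y) * t (m - m)"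
    proof -
      have "y \<bullet> (N ^^ (m - 1 - j)) y = t (m - j)" if "j < m" for j
        using t[of "m - 1 - j"] that by (simp add: Suc_diff_Suc)
      then show ?thesis by (simp add: assms(3) mult.commute)
    qed
    also have "\<dots> = (\<Sum>j\<le>m. (y \<bullet> (N' ^^ j) y) * t (m - j))"
      by (simp add: lessThan_Suc_atMost[symmetric])
    also have "\<dots> = (\<Sum>j\<le>m. (y \<bullet> (N' ^^ j) y) * renewal (\<lambda>j. y \<bullet> (N' ^^ j) y) (m - j))"
      using less Suc by (intro sum.cong refl) simp
    finally show ?thesis by (simp add: Suc)
  qed (simp add: assms)
qed

lemma polyf_renewal [intro]:
  assumes "\<And>j. polyf (\<lambda>x. q x j)"
  shows "polyf (\<lambda>x. renewal (q x) k)"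
proof (induction k rule: less_induct)
  case (less k)
  then show ?case using assms
    by (cases k) (auto intro!: polyf_sum polyf_mult)
qed

text \<open>A renewal sequence is a polynomial in \<open>q\<close> with nonnegative coefficients, so
  bounds on mixed moments of \<open>q\<close> suffice. \<open>J\<close> collects the factors already
  extracted, \<open>ks\<close> the renewal terms still to be expanded; since \<open>Suc m\<close> is
  split into \<open>Suc j\<close> and \<open>m - j\<close>, the degree budget \<open>p\<close> is
  preserved.\<close>

lemma (in gauss_family) GE_renewal_le:
  assumes poly: "\<And>j. polyf (\<lambda>x. q x j)"
    and le: "\<And>J. sum_list (map Suc J) \<le> p \<Longrightarrow> GE (\<lambda>x. \<Prod>j\<leftarrow>J. q x j) \<le> (\<Prod>j\<leftarrow>J. r j)"
    and "sum_list (map Suc J) + sum_list ks \<le> p"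
  shows "GE (\<lambda>x. (\<Prod>j\<leftarrow>J. q x j) * (\<Prod>k\<leftarrow>ks. renewal (q x) k))
    \<le> (\<Prod>j\<leftarrow>J. r j) * (\<Prod>k\<leftarrow>ks. renewal r k)"
  using assms(3)
proof (induction "sum_list ks + length ks" arbitrary: J ks rule: less_induct)
  case less
  show ?case
  proof (cases ks)
    case Nil
    then show ?thesis using le[of J] less.prems by simp
  next
    case (Cons k ks')
    show ?thesis
    proof (cases k)
      case 0
      then show ?thesis using less.hyps[of ks' J] less.prems Cons by simp
    next
      case (Suc m)
      have "GE (\<lambda>x. (\<Prod>j\<leftarrow>J. q x j) * (\<Prod>k\<leftarrow>ks. renewal (q x) k))
         = GE (\<lambda>x. \<Sum>j\<le>m. (\<Prod>j\<leftarrow>j # J. q x j) * (\<Prod>k\<leftarrow>(m - j) # ks'. renewal (q x) k))"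
        by (simp add: Cons Suc sum_distrib_left sum_distrib_right ac_simps)
      also have "\<dots> = (\<Sum>j\<le>m. GE (\<lambda>x. (\<Prod>j\<leftarrow>j # J. q x j) * (\<Prod>k\<leftarrow>(m - j) # ks'. renewal (q x) k)))"
        by (intro GE_sum polyf_intros polyf_renewal poly)
      also have "\<dots> \<le> (\<Sum>j\<le>m. (\<Prod>j\<leftarrow>j # J. r j) * (\<Prod>k\<leftarrow>(m - j) # ks'. renewal r k))"
        using less.prems Cons Suc by (intro sum_mono less.hyps) auto
      also have "\<dots> = (\<Prod>j\<leftarrow>J. r j) * (\<Prod>k\<leftarrow>ks. renewal r k)"
        by (simp add: Cons Suc sum_distrib_left sum_distrib_right ac_simps)
      finally show ?thesis .
    qed
  qed
qed

section \<open>Moments of rectangular Gaussian matrices\<close>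

text \<open>Rows and columns are removed by zero padding, so that the induction can shrink the
  matrix without changing its type.\<close>

definition submat :: "'n set \<Rightarrow> 'm set \<Rightarrow> ('n \<times> 'm \<Rightarrow> real) \<Rightarrow> real^'m::finite^'n::finite" where
  "submat S T x = (\<chi> i j. if i \<in> S \<and> j \<in> T then x (i, j) else 0)"

definition gram :: "real^'m::finite^'n::finite \<Rightarrow> real^'n \<Rightarrow> real^'n" where
  "gram A v = A *v (transpose A *v v)"

definition gform :: "real^'m::finite^'n::finite \<Rightarrow> nat \<Rightarrow> real^'n \<Rightarrow> real" where
  "gform A k v = v \<bullet> (gram A ^^ k) v"

lemma linear_gram: "linear (gram A)"
  unfolding gram_def by (intro linearI) (simp_all add: matrix_vector_right_distrib scaleR_matrix_vector_assoc[symmetric] vec.scale matrix_vector_mult_scaleR)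

lemma linear_funpow:
  fixes f :: "'b::real_vector \<Rightarrow> 'b"
  assumes "linear f"
  shows "linear (f ^^ k)"
proof (induction k)
  case 0
  show ?case by (simp add: linear_id[unfolded id_def] id_def)
next
  case (Suc k)
  then show ?case using linear_compose[OF Suc assms] by (simp add: comp_def)
qed

lemma inner_matrix_vector: "v \<bullet> (A *v w) = (transpose A *v v) \<bullet> w" for A :: "real^'m::finite^'n::finite"
  by (simp add: dot_lmul_matrix)

lemma inner_gram: "v \<bullet> gram A w = gram A v \<bullet> w"
  by (simp add: gram_def inner_matrix_vector del: transpose_matrix_vector)

lemma inner_gram_power: "v \<bullet> (gram A ^^ k) w = (gram A ^^ k) v \<bullet> w"
proof (induction k arbitrary: v)
  case (Suc k)
  then show ?case by (simp add: inner_gram) (simp add: funpow_swap1)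
qed simp

lemma gform_0 [simp]: "gform A 0 v = v \<bullet> v"
  by (simp add: gform_def)

lemma gform_scaleR: "gform A k (c *\<^sub>R v) = c\<^sup>2 * gform A k v"
  by (simp add: gform_def linear_cmul[OF linear_funpow[OF linear_gram]] power2_eq_square)

lemma transpose_submat: "transpose (submat S T x) = submat T S (\<lambda>e. x (prod.swap e))"
  by (simp add: submat_def transpose_def vec_eq_iff conj_commute)

lemma submat_mult_component:
  "(submat S T x *v v) $ i = (if i \<in> S then \<Sum>j\<in>T. x (i, j) * v $ j else 0)"
proof -
  have "(\<Sum>j\<in>UNIV. (if j \<in> T then x (i, j) else 0) * v $ j) = (\<Sum>j\<in>T. x (i, j) * v $ j)"
    by (intro sum.mono_neutral_cong_right) auto
  then show ?thesis
    by (simp add: submat_def matrix_vector_mult_def)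
qed

lemma gram_submat_component:
  "gram (submat S T x) v $ i
    = (if i \<in> S then \<Sum>j\<in>T. x (i, j) * (\<Sum>l\<in>S. x (l, j) * v $ l) else 0)"
  by (simp add: gram_def transpose_submat submat_mult_component del: transpose_matrix_vector)

lemma polyf_gram_power:
  assumes "\<And>i. polyf (\<lambda>x. v x $ i)" "\<And>e. polyf (\<lambda>x. \<phi> x e)"
  shows "polyf (\<lambda>x. (gram (submat S T (\<phi> x)) ^^ k) (v x) $ i)"
proof (induction k arbitrary: i)
  case (Suc k)
  have "polyf (\<lambda>x. if i \<in> S then \<Sum>j\<in>T. \<phi> x (i, j) *
      (\<Sum>l\<in>S. \<phi> x (l, j) * (gram (submat S T (\<phi> x)) ^^ k) (v x) $ l) else 0)"
    by (intro polyf_intros assms Suc)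
  then show ?case by (simp add: gram_submat_component)
qed (simp add: assms)

lemma polyf_gform:
  assumes "\<And>i. polyf (\<lambda>x. v x $ i)" "\<And>e. polyf (\<lambda>x. \<phi> x e)"
  shows "polyf (\<lambda>x. gform (submat S T (\<phi> x)) k (v x))"
  unfolding gform_def inner_vec_def inner_real_def
  by (intro polyf_intros polyf_gram_power assms)

subsection \<open>Rotation\<close>

text \<open>The reflection along \<open>w\<close>; for \<open>w = 0\<close> division by zero makes
  it the identity.\<close>

definition householder :: "real^'n \<Rightarrow> real^'n^'n::finite" where
  "householder w = (\<chi> i l. (if i = l then 1 else 0) - 2 * w $ i * w $ l / (w \<bullet> w))"

lemma householder_orthonormal:
  "(\<Sum>l\<in>UNIV. householder w $ i $ l * householder w $ i' $ l) = (if i = i' then 1 else 0)"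
proof -
  have ww: "w \<bullet> w = (\<Sum>l\<in>UNIV. w $ l * w $ l)"
    by (simp add: inner_vec_def)
  have "(\<Sum>l\<in>UNIV. householder w $ i $ l * householder w $ i' $ l)
    = (\<Sum>l\<in>UNIV. (if l = i then (if i = i' then 1 else 0) else 0)
        - (if l = i then 2 * w $ i' * w $ l / (w \<bullet> w) else 0)
        - (if l = i' then 2 * w $ i * w $ l / (w \<bullet> w) else 0)
        + (2 * w $ i / (w \<bullet> w)) * (2 * w $ i' / (w \<bullet> w)) * (w $ l * w $ l))"
    by (intro sum.cong refl) (auto simp: householder_def algebra_simps)
  also have "\<dots> = (if i = i' then 1 else 0) - 2 * w $ i' * w $ i / (w \<bullet> w)
        - 2 * w $ i * w $ i' / (w \<bullet> w)
        + (2 * w $ i / (w \<bullet> w)) * (2 * w $ i' / (w \<bullet> w)) * (w \<bullet> w)"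
    unfolding sum.distrib sum_subtractf sum_distrib_left[symmetric] ww[symmetric] by simp
  also have "\<dots> = (if i = i' then 1 else 0)"
    by (cases "w \<bullet> w = 0") (simp_all add: field_simps)
  finally show ?thesis .
qed

lemma householder_mult: "householder w *v v = v - (2 * (w \<bullet> v) / (w \<bullet> w)) *\<^sub>R w"
proof -
  have "(\<Sum>l\<in>UNIV. householder w $ i $ l * v $ l) = v $ i - (2 * (w \<bullet> v) / (w \<bullet> w)) * w $ i" for i
  proof -
    have "(\<Sum>l\<in>UNIV. householder w $ i $ l * v $ l)
      = (\<Sum>l\<in>UNIV. (if l = i then v $ l else 0) - (2 * w $ i / (w \<bullet> w)) * (w $ l * v $ l))"
      by (intro sum.cong refl) (auto simp: householder_def algebra_simps)
    also have "\<dots> = v $ i - (2 * w $ i / (w \<bullet> w)) * (\<Sum>l\<in>UNIV. w $ l * v $ l)"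
      by (simp add: sum_subtractf sum_distrib_left)
    finally show ?thesis by (simp add: inner_vec_def mult.commute)
  qed
  then show ?thesis by (simp add: vec_eq_iff matrix_vector_mult_def)
qed

lemma householder_invol: "householder w *v (householder w *v v) = v"
proof (cases "w \<bullet> w = 0")
  case False
  then show ?thesis
    by (simp add: householder_mult inner_diff_right vec_eq_iff field_simps)
qed (simp add: householder_mult)

lemma householder_symmetric: "transpose (householder w) = householder w"
  by (auto simp: householder_def transpose_def vec_eq_iff)

lemma householder_reflects:
  assumes "norm u = norm v"
  shows "householder (v - u) *v v = u"
proof (cases "u = v")
  case False
  have "(v - u) \<bullet> (v - u) = 2 * ((v - u) \<bullet> v)"
    using assms by (simp add: norm_eq inner_diff_left inner_diff_right inner_commute)
  moreover have "(v - u) \<bullet> (v - u) \<noteq> 0"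
    using False by (metis inner_eq_zero_iff right_minus_eq)
  ultimately have "2 * ((v - u) \<bullet> v) / ((v - u) \<bullet> (v - u)) = 1"
    by (metis divide_self)
  then show ?thesis by (simp only: householder_mult) simp
qed (simp add: householder_mult)

lemma gform_householder:
  fixes X :: "real^'m::finite^'n::finite"
  shows "gform (householder w ** X) k v = gform X k (householder w *v v)"
proof -
  let ?H = "\<lambda>v. householder w *v v"
  have g: "gram (householder w ** X) v = ?H (gram X (?H v))" for v
    by (simp add: gram_def matrix_transpose_mul householder_symmetric matrix_vector_mul_assoc[symmetric]
        del: transpose_matrix_vector)
  have "(gram (householder w ** X) ^^ k) v = ?H ((gram X ^^ k) (?H v))"
    by (induction k) (simp_all add: g householder_invol)
  then show ?thesis
    by (simp add: gform_def inner_matrix_vector householder_symmetric del: transpose_matrix_vector)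
qed

text \<open>A reflection of the row space takes \<open>axis c 1\<close> to the direction of
  \<open>v\<close> and leaves Gaussian expectations unchanged. As \<open>v\<close> and
  \<open>axis c 1\<close> are supported in \<open>S\<close>, the reflection does not mix
  \<open>S\<close> with its complement, hence is compatible with the zero padding.\<close>

lemma GE_gform_rotate:
  fixes g :: "'n::finite \<times> 'm::finite \<Rightarrow> 'a \<Rightarrow> real" and v :: "real^'n"
  assumes "gauss_family M g" "c \<in> S" and supp: "\<And>i. i \<notin> S \<Longrightarrow> v $ i = 0"
  shows "gauss_family.GE M g (\<lambda>x. \<Prod>j\<leftarrow>J. gform (submat S T x) j v)
    = (v \<bullet> v) ^ length J * gauss_family.GE M g (\<lambda>x. \<Prod>j\<leftarrow>J. gform (submat S T x) j (axis c 1))"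
proof -
  interpret gauss_family M g by fact
  interpret finite_gauss_family M g by unfold_locales
  \<comment> \<open>For \<open>v = 0\<close> any unit vector supported in \<open>S\<close> works,
    because \<open>v = norm v *\<^sub>R u\<close> still holds.\<close>
  define u where "u = (if v = 0 then axis c 1 else v /\<^sub>R norm v)"
  have u: "norm u = 1" "v = norm v *\<^sub>R u" by (auto simp: u_def norm_axis_1)
  define w where "w = axis c 1 - u"
  have w: "w $ i = 0" if "i \<notin> S" for i
    using that supp assms(2) by (auto simp: w_def u_def axis_def)
  define H where "H = householder w"
  have Hc: "H *v axis c 1 = u"
    unfolding H_def w_def by (rule householder_reflects) (simp add: u norm_axis_1)
  have Hz: "H $ i $ l = 0" if "(i \<in> S) \<noteq> (l \<in> S)" for i l
    using that w by (auto simp: H_def householder_def)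
  define h where "h e f = (if snd e = snd f then H $ fst e $ fst f else 0)" for e f :: "'n \<times> 'm"
  have sumh: "(\<Sum>f\<in>UNIV. h e f * F f) = (\<Sum>l\<in>UNIV. H $ fst e $ l * F (l, snd e))" for e F
  proof -
    have "(\<Sum>f\<in>UNIV. h e f * F f) = (\<Sum>l\<in>UNIV. \<Sum>j\<in>UNIV. h e (l, j) * F (l, j))"
      by (simp add: sum.cartesian_product UNIV_Times_UNIV[symmetric] del: UNIV_Times_UNIV)
    also have "\<dots> = (\<Sum>l\<in>UNIV. \<Sum>j\<in>UNIV. if j = snd e then H $ fst e $ l * F (l, j) else 0)"
      by (intro sum.cong refl) (auto simp: h_def)
    finally show ?thesis by simp
  qed
  have "(\<Sum>f\<in>UNIV. h e f * h e' f) = (if e = e' then 1 else 0)" for e e'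
    unfolding sumh unfolding h_def fst_conv snd_conv H_def
    by (cases "snd e' = snd e") (auto simp: householder_orthonormal prod_eq_iff)
  note rot = GE_rotate[OF this]
  have sub: "submat S T (\<lambda>e. \<Sum>f\<in>UNIV. h e f * x f) = H ** submat S T x" for x
  proof -
    have "(\<Sum>l\<in>UNIV. H $ i $ l * (if l \<in> S \<and> j \<in> T then x (l, j) else 0))
        = (if i \<in> S \<and> j \<in> T then \<Sum>l\<in>UNIV. H $ i $ l * x (l, j) else 0)" for i j
      using Hz by (auto intro!: sum.cong sum.neutral)
    then show ?thesis
      by (simp add: vec_eq_iff submat_def matrix_matrix_mult_def sumh)
  qed
  have "GE (\<lambda>x. \<Prod>j\<leftarrow>J. gform (submat S T x) j v)
      = GE (\<lambda>x. (norm v)\<^sup>2 ^ length J * (\<Prod>j\<leftarrow>J. gform (submat S T x) j u))"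
  proof -
    have "(\<Prod>j\<leftarrow>J. gform (submat S T x) j v) = (norm v)\<^sup>2 ^ length J * (\<Prod>j\<leftarrow>J. gform (submat S T x) j u)" for x
      by (subst u(2), unfold gform_scaleR, induction J) auto
    then show ?thesis by simp
  qed
  also have "\<dots> = (v \<bullet> v) ^ length J * GE (\<lambda>x. \<Prod>j\<leftarrow>J. gform (submat S T x) j u)"
    by (simp add: GE_cmult power2_norm_eq_inner)
  also have "GE (\<lambda>x. \<Prod>j\<leftarrow>J. gform (submat S T x) j u) =
      GE (\<lambda>x. \<Prod>j\<leftarrow>J. gform (submat S T (\<lambda>e. \<Sum>f\<in>UNIV. h e f * x f)) j (axis c 1))"
    unfolding sub unfolding H_def gform_householder unfolding H_def[symmetric] Hc ..
  also have "\<dots> = GE (\<lambda>x. \<Prod>j\<leftarrow>J. gform (submat S T x) j (axis c 1))"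
    by (rule rot) (intro polyf_intros polyf_gform)
  finally show ?thesis .
qed

subsection \<open>Bidiagonalization\<close>

text \<open>With \<open>y\<close> the \<open>i\<close>-th row, the diagonal entry of the
  \<open>Suc k\<close>-th power is the quadratic form at \<open>y\<close> of the \<open>k\<close>-th
  power of the transposed Gram operator. That operator is the one without row \<open>i\<close> plus
  the rank-one term of \<open>y\<close>, so \<open>rank_one_renewal\<close> applies.\<close>

lemma gform_axis_renewal:
  fixes x :: "'n::finite \<times> 'm::finite \<Rightarrow> real" and S :: "'n set" and T :: "'m set"
  assumes i: "i \<in> S"
  defines "y \<equiv> \<chi> j. if j \<in> T then x (i, j) else 0"
  shows "gform (submat S T x) k (axis i 1)
    = renewal (\<lambda>j. gform (submat T (S - {i}) (\<lambda>e. x (prod.swap e))) j y) k"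
proof -
  define X where "X = submat S T x"
  define Xt where "Xt = submat T S (\<lambda>e. x (prod.swap e))"
  have tr: "transpose X = Xt" "transpose Xt = X"
    by (simp_all add: X_def Xt_def transpose_submat)
  have y: "transpose X *v axis i 1 = y"
    using i by (simp add: tr Xt_def vec_eq_iff submat_mult_component y_def axis_def if_distrib cong: if_cong del: transpose_matrix_vector)
  have comm: "transpose X *v (gram X ^^ k) v = (gram (transpose X) ^^ k) (transpose X *v v)" for k v
    by (induction k) (simp_all add: gram_def del: transpose_matrix_vector)
  show ?thesis
    unfolding gform_def
  proof (rule rank_one_renewal[where N="gram Xt"])
    fix v :: "real^'m"
    have "gram Xt v $ j = gram (submat T (S - {i}) (\<lambda>e. x (prod.swap e))) v $ j + ((y \<bullet> v) *\<^sub>R y) $ j" for j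
    proof -
      have yv: "y \<bullet> v = (\<Sum>l\<in>T. x (i, l) * v $ l)"
        unfolding inner_vec_def y_def by (intro sum.mono_neutral_cong_right) auto
      show ?thesis
        using i unfolding scaleR_vec_def yv by (simp add: Xt_def gram_submat_component sum.remove[of S i] y_def)
    qed
    then show "gram Xt v = gram (submat T (S - {i}) (\<lambda>e. x (prod.swap e))) v + (y \<bullet> v) *\<^sub>R y"
      by (simp add: vec_eq_iff)
  next
    fix k
    have "axis i 1 \<bullet> (gram X ^^ Suc k) (axis i 1) = (transpose X *v axis i 1) \<bullet> (transpose X *v (gram X ^^ k) (axis i 1))"
      by (simp add: gram_def inner_matrix_vector del: transpose_matrix_vector)
    also have "\<dots> = y \<bullet> (gram Xt ^^ k) y"
      unfolding comm y unfolding tr ..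
    finally show "axis i 1 \<bullet> (gram (submat S T x) ^^ Suc k) (axis i 1) = y \<bullet> (gram Xt ^^ k) y"
      by (simp add: X_def)
  qed (auto simp: linear_gram)
qed

text \<open>Products over \<open>ks\<close> are needed because the recursion produces correlated
  products. The weight of up-steps from even levels uses \<open>card T\<close>, the number of
  entries in a row, that from odd levels \<open>card S\<close>.\<close>

definition row_bound :: "'a measure \<Rightarrow> ('n::finite \<times> 'm::finite \<Rightarrow> 'a \<Rightarrow> real) \<Rightarrow> nat \<Rightarrow> 'n set \<Rightarrow> 'm set \<Rightarrow> bool" where
  "row_bound M g p S T \<longleftrightarrow> (\<forall>i\<in>S. \<forall>ks. sum_list ks \<le> p \<longrightarrow>
    gauss_family.GE M g (\<lambda>x. \<Prod>k\<leftarrow>ks. gform (submat S T x) k (axis i 1))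
      \<le> (\<Prod>k\<leftarrow>ks. dyck (real (card T) + (2 * real p - 1)) (real (card S) + (2 * real p - 1)) k))"

lemma prod_list_mono_nonneg:
  fixes f h :: "'b \<Rightarrow> real"
  assumes "\<And>x. x \<in> set xs \<Longrightarrow> 0 \<le> f x" "\<And>x. x \<in> set xs \<Longrightarrow> f x \<le> h x"
  shows "0 \<le> (\<Prod>x\<leftarrow>xs. f x)" "(\<Prod>x\<leftarrow>xs. f x) \<le> (\<Prod>x\<leftarrow>xs. h x)"
proof -
  have "0 \<le> (\<Prod>x\<leftarrow>xs. f x) \<and> (\<Prod>x\<leftarrow>xs. f x) \<le> (\<Prod>x\<leftarrow>xs. h x)"
    using assms
  proof (induction xs)
    case (Cons a xs)
    have "0 \<le> f a" "f a \<le> h a" "0 \<le> (\<Prod>x\<leftarrow>xs. f x)" "(\<Prod>x\<leftarrow>xs. f x) \<le> (\<Prod>x\<leftarrow>xs. h x)"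
      using Cons by auto
    then show ?case by (auto intro!: mult_mono mult_nonneg_nonneg)
  qed auto
  then show "0 \<le> (\<Prod>x\<leftarrow>xs. f x)" "(\<Prod>x\<leftarrow>xs. f x) \<le> (\<Prod>x\<leftarrow>xs. h x)" by auto
qed

text \<open>Row \<open>i\<close> is independent of the other rows. For fixed \<open>y\<close>,
  rotation replaces it by a multiple of a coordinate vector, so a monomial in \<open>q\<close> has
  as expectation a chi-square moment times a diagonal moment of the transposed matrix without row
  \<open>i\<close>.\<close>

lemma row_bound_step:
  fixes g :: "'n::finite \<times> 'm::finite \<Rightarrow> 'a \<Rightarrow> real"
  assumes gf: "gauss_family M g" and p: "p \<ge> 1"
    and step: "\<And>i. i \<in> S \<Longrightarrow> row_bound M (\<lambda>e. g (prod.swap e)) p T (S - {i})"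
  shows "row_bound M g p S T"
  unfolding row_bound_def
proof (intro ballI allI impI)
  fix i ks assume i: "i \<in> S" and ks: "sum_list ks \<le> p"
  interpret gauss_family M g by fact
  have gfs: "gauss_family M (\<lambda>e. g (prod.swap e))"
    by (rule gauss_family_reindex[OF gf]) simp
  interpret sw: gauss_family M "\<lambda>e. g (prod.swap e)" by (rule gfs)
  define A where "A = real (card T) + (2 * real p - 1)"
  define B where "B = real (card S) + (2 * real p - 1)"
  have AB: "A \<ge> 1" "B \<ge> 1" using p by (auto simp: A_def B_def)
  define S' where "S' = S - {i}"
  define y :: "('n \<times> 'm \<Rightarrow> real) \<Rightarrow> real^'m" where "y x = (\<chi> j. if j \<in> T then x (i, j) else 0)" for x
  define q where "q x j = gform (submat T S' (\<lambda>e. x (prod.swap e))) j (y x)" for x j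
  have py: "polyf (\<lambda>x. y x $ j)" for j
    by (simp add: y_def) (intro polyf_intros)
  have pq: "polyf (\<lambda>x. q x j)" for j
    unfolding q_def by (intro polyf_gform py polyf_intros)
  have ren: "gform (submat S T x) k (axis i 1) = renewal (q x) k" for x k
    unfolding q_def y_def S'_def by (rule gform_axis_renewal[OF i])
  have q_le: "GE (\<lambda>x. \<Prod>j\<leftarrow>J. q x j) \<le> (\<Prod>j\<leftarrow>J. A * dyck B A j)"
    if J: "sum_list (map Suc J) \<le> p" for J
  proof (cases "T = {}")
    \<comment> \<open>Without columns there is no coordinate vector to rotate to; here
      \<open>y\<close> and all \<open>q x j\<close> vanish.\<close>
    case True
    then have "y x = 0" for x by (simp add: y_def vec_eq_iff)
    then have "q x j = 0" for x j
      using gform_scaleR[of _ j 0 0] by (simp add: q_def)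
    then have "(\<Prod>j\<leftarrow>J. q x j) = (if J = [] then 1 else 0)" for x by (induction J) auto
    moreover have "0 \<le> (\<Prod>j\<leftarrow>J. A * dyck B A j)"
      using AB by (intro prod_list_mono_nonneg(1)[where h="\<lambda>j. A * dyck B A j"] mult_nonneg_nonneg dyck_nonneg) auto
    ultimately show ?thesis by auto
  next
    case False
    then obtain c where c: "c \<in> T" by auto
    define K where "K = sw.GE (\<lambda>x. \<Prod>j\<leftarrow>J. gform (submat T S' x) j (axis c 1))"
    have lenJ: "sum_list J \<le> p" "length J \<le> p"
      using J by (induction J arbitrary: p) (fastforce simp: le_diff_conv2)+
    have K_le: "K \<le> (\<Prod>j\<leftarrow>J. dyck B A j)"
    proof -
      have "K \<le> (\<Prod>j\<leftarrow>J. dyck (real (card S') + (2 * real p - 1)) A j)"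
        using step[OF i] c lenJ unfolding row_bound_def K_def S'_def A_def by blast
      \<comment> \<open>Losing row \<open>i\<close> only lowers a weight; restoring it makes the two
        weights recur unchanged.\<close>
      also have "\<dots> \<le> (\<Prod>j\<leftarrow>J. dyck B A j)"
        using AB p card_mono[of S S'] unfolding S'_def B_def
        by (intro prod_list_mono_nonneg(2) dyck_nonneg dyck_mono) auto
      finally show ?thesis .
    qed
    have "GE (\<lambda>x. \<Prod>j\<leftarrow>J. q x j) = GE (\<lambda>x. GE (\<lambda>z. \<Prod>j\<leftarrow>J. q (\<lambda>e. if e \<in> {i} \<times> UNIV then x e else z e) j))"
      by (rule GE_split) (intro polyf_intros pq)
    also have "\<dots> = GE (\<lambda>x. GE (\<lambda>z. \<Prod>j\<leftarrow>J. gform (submat T S' (\<lambda>e. z (prod.swap e))) j (y x)))"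
    proof -
      have "q (\<lambda>e. if e \<in> {i} \<times> UNIV then x e else z e) j = gform (submat T S' (\<lambda>e. z (prod.swap e))) j (y x)" for x z j
      proof -
        have "submat T S' (\<lambda>e. (\<lambda>e. if e \<in> {i} \<times> UNIV then x e else z e) (prod.swap e)) = submat T S' (\<lambda>e. z (prod.swap e))"
          by (auto simp: submat_def vec_eq_iff S'_def)
        moreover have "y (\<lambda>e. if e \<in> {i} \<times> UNIV then x e else z e) = y x"
          by (auto simp: y_def vec_eq_iff)
        ultimately show ?thesis by (simp add: q_def)
      qed
      then show ?thesis by simp
    qed
    also have "\<dots> = GE (\<lambda>x. (y x \<bullet> y x) ^ length J * K)"
    proof -
      have "GE (\<lambda>z. \<Prod>j\<leftarrow>J. gform (submat T S' (\<lambda>e. z (prod.swap e))) j v) = (v \<bullet> v) ^ length J * K"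
        if "\<And>j. j \<notin> T \<Longrightarrow> v $ j = 0" for v
        using GE_gform_rotate[OF gfs c that, where J=J and T=S'] unfolding K_def GE_def sw.GE_def by simp
      then show ?thesis by (simp add: y_def)
    qed
    also have "\<dots> = GE (\<lambda>x. (\<Sum>e\<in>{i} \<times> T. (x e)\<^sup>2) ^ length J) * K"
    proof -
      have "y x \<bullet> y x = (\<Sum>e\<in>{i} \<times> T. (x e)\<^sup>2)" for x
      proof -
        have "y x \<bullet> y x = (\<Sum>j\<in>T. (x (i, j))\<^sup>2)"
          unfolding inner_vec_def y_def
          by (intro sum.mono_neutral_cong_right) (auto simp: power2_eq_square)
        also have "\<dots> = (\<Sum>e\<in>{i} \<times> T. (x e)\<^sup>2)"
          by (intro sum.reindex_bij_witness[of _ snd "Pair i"]) auto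
        finally show ?thesis .
      qed
      then show ?thesis by (simp add: GE_multc)
    qed
    also have "\<dots> \<le> GE (\<lambda>x. (\<Sum>e\<in>{i} \<times> T. (x e)\<^sup>2) ^ length J) * (\<Prod>j\<leftarrow>J. dyck B A j)"
      by (intro mult_left_mono K_le) (simp add: GE_def Bochner_Integration.integral_nonneg sum_nonneg)
    also have "\<dots> \<le> A ^ length J * (\<Prod>j\<leftarrow>J. dyck B A j)"
      using GE_power_sum_squares_le[of "{i} \<times> T" "length J" p] lenJ AB
      by (intro mult_right_mono prod_list_mono_nonneg(1)[where h="dyck B A"] dyck_nonneg)
         (auto simp: A_def card_cartesian_product)
    also have "\<dots> = (\<Prod>j\<leftarrow>J. A * dyck B A j)"
      by (induction J) auto
    finally show ?thesis .
  qed
  have "GE (\<lambda>x. \<Prod>k\<leftarrow>ks. gform (submat S T x) k (axis i 1)) \<le> (\<Prod>k\<leftarrow>ks. dyck A B k)"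
    using GE_renewal_le[where q=q and J="[]" and r="\<lambda>j. A * dyck B A j", OF pq q_le, where ks=ks and p=p] ks
    by (simp add: ren renewal_dyck)
  then show "GE (\<lambda>x. \<Prod>k\<leftarrow>ks. gform (submat S T x) k (axis i 1))
    \<le> (\<Prod>k\<leftarrow>ks. dyck (real (card T) + (2 * real p - 1)) (real (card S) + (2 * real p - 1)) k)"
    by (simp add: A_def B_def)
qed

text \<open>Each step transposes the matrix and removes one row, so both orientations are handled in
  one induction on \<open>card S + card T\<close>.\<close>

lemma row_bound:
  fixes g :: "'n::finite \<times> 'm::finite \<Rightarrow> 'a \<Rightarrow> real"
  assumes gf: "gauss_family M g" and p: "p \<ge> 1"
  shows "row_bound M g p S T"
proof -
  have gfs: "gauss_family M (\<lambda>e. g (prod.swap e))"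
    by (rule gauss_family_reindex[OF gf]) simp
  have "(\<forall>S T. card S + card T = N \<longrightarrow> row_bound M g p S T) \<and>
        (\<forall>T S. card T + card S = N \<longrightarrow> row_bound M (\<lambda>e. g (prod.swap e)) p T S)" for N
  proof (induction N rule: less_induct)
    case (less N)
    have "row_bound M g p S T" if N: "card S + card T = N" for S T
    proof (rule row_bound_step[OF gf p])
      fix i assume "i \<in> S"
      then have "card (S - {i}) < card S" by (intro card_Diff1_less) auto
      then show "row_bound M (\<lambda>e. g (prod.swap e)) p T (S - {i})"
        using less[of "card T + card (S - {i})"] N by auto
    qed
    moreover have "row_bound M (\<lambda>e. g (prod.swap e)) p T S" if N: "card T + card S = N" for S T
    proof (rule row_bound_step[OF gfs p])
      fix i assume "i \<in> T"
      then have "card (T - {i}) < card T" by (intro card_Diff1_less) auto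
      then show "row_bound M (\<lambda>e. g (prod.swap (prod.swap e))) p S (T - {i})"
        using less[of "card S + card (T - {i})"] N by auto
    qed
    ultimately show ?case by blast
  qed
  then show ?thesis by blast
qed

lemma GE_gform_axis_le:
  fixes g :: "'n::finite \<times> 'm::finite \<Rightarrow> 'a \<Rightarrow> real"
  assumes "gauss_family M g" "p \<ge> 1" "i \<in> S"
  shows "gauss_family.GE M g (\<lambda>x. gform (submat S T x) p (axis i 1))
    \<le> (sqrt (real (card T) + (2 * real p - 1)) + sqrt (real (card S) + (2 * real p - 1))) ^ (2 * p)"
proof -
  have "gauss_family.GE M g (\<lambda>x. gform (submat S T x) p (axis i 1))
      \<le> dyck (real (card T) + (2 * real p - 1)) (real (card S) + (2 * real p - 1)) p"
    using row_bound[OF assms(1,2), of S T] assms(3) unfolding row_bound_def by (auto dest!: bspec spec[of _ "[p]"])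
  also have "\<dots> \<le> (sqrt (real (card T) + (2 * real p - 1)) + sqrt (real (card S) + (2 * real p - 1))) ^ (2 * p)"
    using assms(2) by (intro dyck_le) auto
  finally show ?thesis .
qed

section \<open>Wick pairings\<close>

lemma set_del_nth:
  assumes "distinct xs" "k < length xs"
  shows "set (del_nth k xs) = set xs - {xs ! k}" "distinct (del_nth k xs)"
proof -
  have "distinct (xs ! k # del_nth k xs)"
    by (metis assms mset.simps(2) mset_del_nth mset_eq_imp_distinct_iff)
  moreover have "insert (xs ! k) (set (del_nth k xs)) = set xs"
    using arg_cong[OF mset_del_nth[OF assms(2)], of set_mset] by simp
  ultimately show "set (del_nth k xs) = set xs - {xs ! k}" "distinct (del_nth k xs)" by auto
qed

lemma sorted_del_nth: "sorted_wrt R xs \<Longrightarrow> sorted_wrt R (del_nth k xs)"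
proof (induction xs arbitrary: k)
  case (Cons a xs)
  have "set (del_nth j xs) \<subseteq> set xs" for j
    using set_take_subset[of j xs] set_drop_subset[of "Suc j" xs] by (auto simp: del_nth_def)
  with Cons show ?case by (cases k) auto
qed (simp add: del_nth_def)

definition matching_of :: "nat list \<Rightarrow> (nat \<times> nat) list \<Rightarrow> bool" where
  "matching_of ps \<pi> \<longleftrightarrow> distinct (map fst \<pi> @ map snd \<pi>) \<and> set (map fst \<pi> @ map snd \<pi>) = set ps
    \<and> (\<forall>(a, b)\<in>set \<pi>. a < b)"

text \<open>Iterating \<open>wick_Cons\<close>. The list \<open>P\<close> is chosen before the
  labels \<open>e\<close>, so the same pairings serve every walk and both matrices to be
  compared.\<close>

lemma wick_pairings:
  assumes "sorted_wrt (<) ps"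
  shows "\<exists>P. (\<forall>\<pi>\<in>set P. matching_of ps \<pi>) \<and>
    (\<forall>e :: nat \<Rightarrow> 'e. wick (map e ps) = (\<Sum>\<pi>\<leftarrow>P. if \<forall>(a, b)\<in>set \<pi>. e a = e b then 1 else 0))"
  using assms
proof (induction ps rule: length_induct)
  case (1 ps)
  show ?case
  proof (cases ps)
    case Nil
    then show ?thesis by (intro exI[of _ "[[]]"]) (auto simp: matching_of_def)
  next
    case (Cons a ps')
    have ps': "sorted_wrt (<) ps'" "distinct ps'" "\<And>b. b \<in> set ps' \<Longrightarrow> a < b"
      using 1(2) Cons by (auto simp: strict_sorted_iff)
    have "\<forall>k\<in>{..<length ps'}. \<exists>P. (\<forall>\<pi>\<in>set P. matching_of (del_nth k ps') \<pi>) \<and>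
      (\<forall>e :: nat \<Rightarrow> 'e. wick (map e (del_nth k ps')) = (\<Sum>\<pi>\<leftarrow>P. if \<forall>(a, b)\<in>set \<pi>. e a = e b then 1 else 0))"
      by (intro ballI 1(1)[THEN spec, THEN mp, THEN mp] sorted_del_nth ps'(1)) (simp add: Cons)
    then obtain P where P: "\<And>k \<pi>. k < length ps' \<Longrightarrow> \<pi> \<in> set (P k) \<Longrightarrow> matching_of (del_nth k ps') \<pi>"
      and W: "\<And>k (e :: nat \<Rightarrow> 'e). k < length ps' \<Longrightarrow>
        wick (map e (del_nth k ps')) = (\<Sum>\<pi>\<leftarrow>P k. if \<forall>(a, b)\<in>set \<pi>. e a = e b then 1 else 0)"
      unfolding bchoice_iff by auto
    define Q where "Q = concat (map (\<lambda>k. map ((#) (a, ps' ! k)) (P k)) [0..<length ps'])"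
    have "matching_of ps \<pi>" if \<pi>: "\<pi> \<in> set Q" for \<pi>
    proof -
      obtain k \<pi>' where k: "k < length ps'" "\<pi>' \<in> set (P k)" "\<pi> = (a, ps' ! k) # \<pi>'"
        using \<pi> by (auto simp: Q_def)
      have m: "distinct (map fst \<pi>' @ map snd \<pi>')" "set (map fst \<pi>' @ map snd \<pi>') = set ps' - {ps' ! k}"
        "\<forall>(a, b)\<in>set \<pi>'. a < b"
        using P[OF k(1,2)] set_del_nth[OF ps'(2) k(1)] by (auto simp: matching_of_def)
      have "a \<notin> set ps'" "ps' ! k \<in> set ps'" using ps'(3) k(1) by auto
      then show ?thesis
        using m ps'(3) unfolding matching_of_def k(3) Cons by auto
    qed
    moreover have "wick (map e ps) = (\<Sum>\<pi>\<leftarrow>Q. if \<forall>(a, b)\<in>set \<pi>. e a = e b then 1 else 0)" for e :: "nat \<Rightarrow> 'e"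
    proof -
      have concat_sum: "sum_list (concat xss) = sum_list (map sum_list xss)" for xss :: "real list list"
        by (induction xss) auto
      have "wick (map e ps) = (\<Sum>k<length ps'. if e (ps' ! k) = e a then wick (map e (del_nth k ps')) else 0)"
        by (simp add: Cons wick_Cons map_del_nth cong: if_cong)
      also have "\<dots> = (\<Sum>k<length ps'. \<Sum>\<pi>\<leftarrow>map ((#) (a, ps' ! k)) (P k). if \<forall>(a, b)\<in>set \<pi>. e a = e b then 1 else 0)"
        by (intro sum.cong refl) (auto simp: W comp_def eq_commute[of "e a"])
      also have "\<dots> = (\<Sum>\<pi>\<leftarrow>Q. if \<forall>(a, b)\<in>set \<pi>. e a = e b then 1 else 0)"
        unfolding Q_def map_concat concat_sum map_map
        by (simp add: comp_def interv_sum_list_conv_sum_set_nat atLeast0LessThan)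
      finally show ?thesis .
    qed
    ultimately show ?thesis by blast
  qed
qed

section \<open>Labelled walks with identified positions\<close>

text \<open>Labellings of the positions up to \<open>N\<close> in which each position agrees with
  its representative \<open>f k\<close>; a position with \<open>f k = k\<close> is free.\<close>

definition walks :: "(nat \<Rightarrow> 'v set) \<Rightarrow> (nat \<Rightarrow> nat) \<Rightarrow> nat \<Rightarrow> (nat \<Rightarrow> 'v) set" where
  "walks D f N = {w \<in> PiE {..N} D. \<forall>k\<le>N. w k = w (f k)}"

lemma finite_walks: "(\<And>k. finite (D k)) \<Longrightarrow> finite (walks D f N)"
  unfolding walks_def by (rule finite_subset[OF _ finite_PiE[of "{..N}" D]]) auto

text \<open>As \<open>f k \<le> k\<close>, no earlier constraint involves the last position: its
  label is either free or forced by the past.\<close>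

lemma sum_walks_Suc:
  assumes f: "\<And>k. f k \<le> k" and D: "\<And>k. finite (D k)"
  shows "(\<Sum>w\<in>walks D f (Suc N). F w)
    = (\<Sum>w\<in>walks D f N. \<Sum>a\<in>{a \<in> D (Suc N). f (Suc N) = Suc N \<or> a = w (f (Suc N))}. F (w(Suc N := a)))"
proof -
  have le: "f (Suc N) \<le> N" if "f (Suc N) \<noteq> Suc N" using f[of "Suc N"] that by simp
  have fne: "f k \<noteq> Suc N" if "k \<le> N" for k using f[of k] that by linarith
  have "(\<Sum>w\<in>walks D f N. \<Sum>a\<in>{a \<in> D (Suc N). f (Suc N) = Suc N \<or> a = w (f (Suc N))}. F (w(Suc N := a)))
    = (\<Sum>(w, a)\<in>(SIGMA w:walks D f N. {a \<in> D (Suc N). f (Suc N) = Suc N \<or> a = w (f (Suc N))}). F (w(Suc N := a)))"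
    using D by (intro sum.Sigma finite_walks) auto
  also have "\<dots> = (\<Sum>w\<in>walks D f (Suc N). F w)"
  proof (rule sum.reindex_bij_witness[where j="\<lambda>(w, a). w(Suc N := a)" and i="\<lambda>w. (restrict w {..N}, w (Suc N))"], goal_cases)
    case (1 p)
    then show ?case by (auto simp: walks_def PiE_iff extensional_def fun_eq_iff)
  next
    case (2 p)
    then obtain w a where p: "p = (w, a)" "w \<in> walks D f N" "a \<in> D (Suc N)" "f (Suc N) = Suc N \<or> a = w (f (Suc N))"
      by auto
    have "(w(Suc N := a)) k = (w(Suc N := a)) (f k)" if "k \<le> Suc N" for k
    proof (cases "k = Suc N")
      case True
      then show ?thesis using p(4) le by (cases "f (Suc N) = Suc N") auto
    next
      case False
      then show ?thesis using that p(2) fne[of k] by (auto simp: walks_def)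
    qed
    moreover have "w(Suc N := a) \<in> PiE {..Suc N} D"
      using p(2,3) by (auto simp: walks_def PiE_iff extensional_def le_Suc_eq)
    ultimately show ?case using p(1) by (simp add: walks_def)
  next
    case (3 w)
    then show ?case by (auto simp: walks_def PiE_iff extensional_def fun_eq_iff le_Suc_eq)
  next
    case (4 w)
    have w: "w k \<in> D k" "w k = w (f k)" if "k \<le> Suc N" for k
      using 4 that by (auto simp: walks_def PiE_iff)
    have "restrict w {..N} k = restrict w {..N} (f k)" if "k \<le> N" for k
      using w(2)[of k] that f[of k] by (auto intro: order_trans)
    moreover have "restrict w {..N} \<in> PiE {..N} D"
      using w(1) by (auto simp: PiE_iff)
    moreover have "f (Suc N) = Suc N \<or> w (Suc N) = restrict w {..N} (f (Suc N))"
      using w(2)[of "Suc N"] le by auto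
    ultimately show ?case using w(1)[of "Suc N"] by (auto simp: walks_def)
  qed auto
  finally show ?thesis by simp
qed

lemma walks_0:
  assumes "f 0 = (0::nat)"
  shows "walks D f 0 = PiE {0} D"
  using assms by (auto simp: walks_def)

text \<open>Labels are summed out from the end, where each occurs in one weight only. A new position
  costs \<open>s\<close>; an old one has at most one label, of weight at most 1.\<close>

lemma sum_walks_le:
  fixes wt :: "nat \<Rightarrow> 'v \<Rightarrow> 'v \<Rightarrow> real" and s :: "nat \<Rightarrow> real"
  assumes f: "\<And>k. f k \<le> k" and D: "\<And>k. finite (D k)"
    and wt0: "\<And>k u v. 0 \<le> wt k u v" and s0: "\<And>k. 0 \<le> s k"
    and new: "\<And>k u. k < N \<Longrightarrow> f (Suc k) = Suc k \<Longrightarrow> u \<in> D k \<Longrightarrow> (\<Sum>v\<in>D (Suc k). wt k u v) \<le> s (Suc k)"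
    and old: "\<And>k u v. k < N \<Longrightarrow> f (Suc k) \<noteq> Suc k \<Longrightarrow> wt k u v \<le> 1"
  shows "(\<Sum>w\<in>walks D f N. \<Prod>k<N. wt k (w k) (w (Suc k)))
    \<le> card (D 0) * (\<Prod>k<N. if f (Suc k) = Suc k then s (Suc k) else 1)"
  using new old
proof (induction N)
  case 0
  have "f 0 = 0" using f[of 0] by simp
  then show ?case by (simp add: walks_0 card_PiE)
next
  case (Suc N)
  let ?A = "\<lambda>w. {a \<in> D (Suc N). f (Suc N) = Suc N \<or> a = w (f (Suc N))}"
  let ?c = "if f (Suc N) = Suc N then s (Suc N) else 1"
  have inner: "(\<Sum>a\<in>?A w. wt N (w N) a) \<le> ?c" if w: "w \<in> walks D f N" for w
  proof (cases "f (Suc N) = Suc N")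
    case True
    have "w N \<in> D N" using w unfolding walks_def by (blast intro: PiE_mem)
    then show ?thesis using Suc.prems(1)[of N "w N"] True by simp
  next
    case False
    have "(\<Sum>a\<in>?A w. wt N (w N) a) \<le> (\<Sum>a\<in>{w (f (Suc N))}. wt N (w N) a)"
      using False wt0 by (intro sum_mono2) auto
    also have "\<dots> \<le> 1" using Suc.prems(2)[of N] False by simp
    finally show ?thesis using False by simp
  qed
  have "(\<Sum>w\<in>walks D f (Suc N). \<Prod>k<Suc N. wt k (w k) (w (Suc k)))
    = (\<Sum>w\<in>walks D f N. \<Sum>a\<in>?A w. \<Prod>k<Suc N. wt k ((w(Suc N := a)) k) ((w(Suc N := a)) (Suc k)))"
    by (rule sum_walks_Suc[OF f D])
  also have "\<dots> = (\<Sum>w\<in>walks D f N. (\<Prod>k<N. wt k (w k) (w (Suc k))) * (\<Sum>a\<in>?A w. wt N (w N) a))"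
    by (simp add: sum_distrib_left)
  also have "\<dots> \<le> (\<Sum>w\<in>walks D f N. (\<Prod>k<N. wt k (w k) (w (Suc k))) * ?c)"
    by (intro sum_mono mult_left_mono inner prod_nonneg wt0)
  also have "\<dots> = (\<Sum>w\<in>walks D f N. \<Prod>k<N. wt k (w k) (w (Suc k))) * ?c"
    by (simp add: sum_distrib_right)
  also have "\<dots> \<le> (card (D 0) * (\<Prod>k<N. if f (Suc k) = Suc k then s (Suc k) else 1)) * ?c"
    using s0 Suc.prems by (intro mult_right_mono Suc.IH) auto
  finally show ?case by (simp add: mult.assoc)
qed

text \<open>The case of unit weights, with equality: \<open>D (f k) = D k\<close> makes every forced
  label admissible.\<close>

lemma card_walks:
  assumes f: "\<And>k. f k \<le> k" and D: "\<And>k. finite (D k)" "\<And>k. D (f k) = D k"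
  shows "real (card (walks D f N)) = card (D 0) * (\<Prod>k<N. if f (Suc k) = Suc k then real (card (D (Suc k))) else 1)"
proof (induction N)
  case 0
  have "f 0 = 0" using f[of 0] by simp
  then show ?case by (simp add: walks_0 card_PiE)
next
  case (Suc N)
  let ?A = "\<lambda>w. {a \<in> D (Suc N). f (Suc N) = Suc N \<or> a = w (f (Suc N))}"
  have inner: "real (card (?A w)) = (if f (Suc N) = Suc N then real (card (D (Suc N))) else 1)"
    if w: "w \<in> walks D f N" for w
  proof (cases "f (Suc N) = Suc N")
    case False
    then have "f (Suc N) \<le> N" using f[of "Suc N"] by simp
    then have "w (f (Suc N)) \<in> D (Suc N)"
      using w unfolding walks_def D(2)[of "Suc N", symmetric] by (blast intro: PiE_mem)
    then have "?A w = {w (f (Suc N))}" using False by auto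
    then show ?thesis using False by simp
  qed simp
  have "real (card (walks D f (Suc N))) = (\<Sum>w\<in>walks D f (Suc N). 1)" by simp
  also have "\<dots> = (\<Sum>w\<in>walks D f N. \<Sum>a\<in>?A w. 1)"
    by (rule sum_walks_Suc[OF f D(1)])
  also have "\<dots> = (\<Sum>w\<in>walks D f N. if f (Suc N) = Suc N then real (card (D (Suc N))) else 1)"
    using inner by (intro sum.cong) auto
  also have "\<dots> = real (card (walks D f N)) * (if f (Suc N) = Suc N then real (card (D (Suc N))) else 1)"
    by simp
  finally show ?case unfolding Suc by (simp only: prod.lessThan_Suc mult.assoc)
qed

text \<open>Taking the least element of each class of the equivalence generated by \<open>C\<close>
  ensures that representatives never lie in the future.\<close>

definition first_index :: "(nat \<times> nat) set \<Rightarrow> nat \<Rightarrow> nat" where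
  "first_index C k = (LEAST l. (k, l) \<in> (C \<union> C\<inverse>)\<^sup>*)"

lemma first_index:
  shows first_index_rel: "(k, first_index C k) \<in> (C \<union> C\<inverse>)\<^sup>*"
    and first_index_le: "first_index C k \<le> k"
    and first_index_eq: "(a, b) \<in> C \<Longrightarrow> first_index C a = first_index C b"
proof -
  show "(k, first_index C k) \<in> (C \<union> C\<inverse>)\<^sup>*"
    unfolding first_index_def by (rule LeastI[of _ k]) simp
  show "first_index C k \<le> k"
    unfolding first_index_def by (rule Least_le) simp
  assume ab: "(a, b) \<in> C"
  have "(a, l) \<in> (C \<union> C\<inverse>)\<^sup>* \<longleftrightarrow> (b, l) \<in> (C \<union> C\<inverse>)\<^sup>*" for l
    using ab by (meson UnCI converseI converse_rtrancl_into_rtrancl)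
  then show "first_index C a = first_index C b" by (simp add: first_index_def)
qed

lemma first_index_invariant:
  assumes "\<And>a b. (a, b) \<in> C \<Longrightarrow> w a = w b"
  shows "w (first_index C k) = w k"
proof -
  have "(k, l) \<in> (C \<union> C\<inverse>)\<^sup>* \<Longrightarrow> w l = w k" for l
    by (induction rule: rtrancl_induct) (use assms in auto)
  then show ?thesis using first_index_rel by blast
qed

lemma walks_first_index:
  assumes "C \<subseteq> {..N} \<times> {..N}"
  shows "walks D (first_index C) N = {w \<in> PiE {..N} D. \<forall>(a, b)\<in>C. w a = w b}"
proof (intro equalityI subsetI)
  fix w assume w: "w \<in> walks D (first_index C) N"
  have "w a = w b" if "(a, b) \<in> C" for a b
  proof -
    have "a \<le> N" "b \<le> N" using that assms by auto
    then have "w a = w (first_index C a)" "w b = w (first_index C b)" using w by (auto simp: walks_def)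
    then show ?thesis using first_index_eq[OF that] by simp
  qed
  then show "w \<in> {w \<in> PiE {..N} D. \<forall>(a, b)\<in>C. w a = w b}" using w by (auto simp: walks_def)
next
  fix w assume w: "w \<in> {w \<in> PiE {..N} D. \<forall>(a, b)\<in>C. w a = w b}"
  then have "w (first_index C k) = w k" for k by (intro first_index_invariant) auto
  then show "w \<in> walks D (first_index C) N" using w by (auto simp: walks_def)
qed

section \<open>Trace expansion over bipartite walks\<close>

text \<open>Steps in either direction between a row and a column use the same matrix entry, so
  orientation is forgotten. Walks alternate sides and never meet the \<open>undefined\<close>
  case.\<close>

fun edge :: "'n + 'm \<Rightarrow> 'n + 'm \<Rightarrow> 'n \<times> 'm" where
  "edge (Inl i) (Inr j) = (i, j)"
| "edge (Inr j) (Inl i) = (i, j)"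
| "edge u v = undefined"

definition sides :: "'n set \<Rightarrow> 'm set \<Rightarrow> nat \<Rightarrow> ('n + 'm) set" where
  "sides S T k = (if even k then Inl ` S else Inr ` T)"

lemma sum_sides:
  "even k \<Longrightarrow> (\<Sum>u\<in>sides S T k. F u) = (\<Sum>i\<in>S. F (Inl i))"
  "odd k \<Longrightarrow> (\<Sum>u\<in>sides S T k. F u) = (\<Sum>j\<in>T. F (Inr j))"
  by (simp_all add: sides_def sum.reindex)

text \<open>The end vector \<open>v\<close> is arbitrary so that the induction can absorb the last
  two steps into it as one application of \<open>gram\<close>; \<open>\<phi>\<close> will select the
  starting row.\<close>

lemma walk_sum_gram:
  fixes x :: "'n::finite \<times> 'm::finite \<Rightarrow> real" and v :: "real^'n"
  shows "(\<Sum>w\<in>PiE {..2 * k} (sides S T). \<phi> (w 0) * (\<Prod>l<2 * k. x (edge (w l) (w (Suc l)))) * case_sum (($) v) (\<lambda>_. 0) (w (2 * k)))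
    = (\<Sum>i\<in>S. \<phi> (Inl i) * (gram (submat S T x) ^^ k) v $ i)"
proof (induction k arbitrary: v)
  case 0
  have "(\<Sum>w\<in>PiE {..0} (sides S T). F (w 0)) = (\<Sum>i\<in>S. F (Inl i))" for F :: "_ \<Rightarrow> real"
    by (rule sum.reindex_bij_witness[where i="\<lambda>i. (\<lambda>k\<in>{..0}. Inl i)" and j="\<lambda>w. projl (w 0)"])
       (auto simp: sides_def PiE_iff extensional_def fun_eq_iff)
  from this[of "\<lambda>u. \<phi> u * case_sum (($) v) (\<lambda>_. 0) u"] show ?case by simp
next
  case (Suc k)
  let ?D = "sides S T" and ?z = "\<lambda>v. case_sum (($) v) (\<lambda>_. 0)"
  have ext: "(\<Sum>w\<in>PiE {..Suc N} ?D. F w) = (\<Sum>w\<in>PiE {..N} ?D. \<Sum>a\<in>?D (Suc N). F (w(Suc N := a)))" for N and F :: "_ \<Rightarrow> real"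
    using sum_walks_Suc[of "\<lambda>k. k" ?D F N] by (simp add: walks_def sides_def)
  have gr: "(\<Sum>a\<in>?D (Suc (2 * k)). \<Sum>b\<in>?D (Suc (Suc (2 * k))). x (edge u a) * x (edge a b) * ?z v b)
      = ?z (gram (submat S T x) v) u" if "u \<in> ?D (2 * k)" for u
  proof -
    obtain i where u: "u = Inl i" "i \<in> S" using \<open>u \<in> _\<close> by (auto simp: sides_def)
    show ?thesis
      by (simp add: sum_sides u gram_submat_component sum_distrib_left mult.assoc)
  qed
  have "(\<Sum>w\<in>PiE {..2 * Suc k} ?D. \<phi> (w 0) * (\<Prod>l<2 * Suc k. x (edge (w l) (w (Suc l)))) * ?z v (w (2 * Suc k)))
    = (\<Sum>w\<in>PiE {..2 * k} ?D. \<Sum>a\<in>?D (Suc (2 * k)). \<Sum>b\<in>?D (Suc (Suc (2 * k))).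
        \<phi> (w 0) * (\<Prod>l<2 * k. x (edge (w l) (w (Suc l)))) * (x (edge (w (2 * k)) a) * x (edge a b) * ?z v b))"
    by (simp add: ext mult.assoc)
  also have "\<dots> = (\<Sum>w\<in>PiE {..2 * k} ?D. \<phi> (w 0) * (\<Prod>l<2 * k. x (edge (w l) (w (Suc l)))) * ?z (gram (submat S T x) v) (w (2 * k)))"
    unfolding sum_distrib_left[symmetric] by (intro sum.cong refl arg_cong2[where f="(*)"] gr) auto
  also have "\<dots> = (\<Sum>i\<in>S. \<phi> (Inl i) * (gram (submat S T x) ^^ Suc k) v $ i)"
    unfolding Suc by (simp add: funpow_swap1)
  finally show ?case .
qed

lemma trace_gram_walks:
  fixes x :: "'n::finite \<times> 'm::finite \<Rightarrow> real"
  shows "(\<Sum>i\<in>S. gform (submat S T x) p (axis i 1))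
    = (\<Sum>w\<in>{w \<in> PiE {..2 * p} (sides S T). w (2 * p) = w 0}. \<Prod>l<2 * p. x (edge (w l) (w (Suc l))))"
proof -
  let ?D = "sides S T"
  have "gform (submat S T x) p (axis i 1) = (\<Sum>w\<in>PiE {..2 * p} ?D. of_bool (w 0 = Inl i)
      * (\<Prod>l<2 * p. x (edge (w l) (w (Suc l)))) * case_sum (($) (axis i 1)) (\<lambda>_. 0) (w (2 * p)))" if "i \<in> S" for i
  proof -
    have "gform (submat S T x) p (axis i 1) = (\<Sum>i'\<in>S. of_bool (Inl i' = (Inl i :: 'n + 'm)) * (gram (submat S T x) ^^ p) (axis i 1) $ i')"
      using that by (simp add: gform_def inner_axis')
    then show ?thesis
      by (subst walk_sum_gram[where \<phi>="\<lambda>u. of_bool (u = Inl i)"])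
  qed
  then have "(\<Sum>i\<in>S. gform (submat S T x) p (axis i 1)) = (\<Sum>w\<in>PiE {..2 * p} ?D.
      (\<Sum>i\<in>S. of_bool (w 0 = Inl i) * case_sum (($) (axis i 1)) (\<lambda>_. 0) (w (2 * p))) * (\<Prod>l<2 * p. x (edge (w l) (w (Suc l)))))"
    by (subst sum_distrib_right, subst sum.swap) (simp add: mult.assoc mult.commute mult.left_commute)
  also have "\<dots> = (\<Sum>w\<in>PiE {..2 * p} ?D. (if w (2 * p) = w 0 then \<Prod>l<2 * p. x (edge (w l) (w (Suc l))) else 0))"
  proof (intro sum.cong refl)
    fix w assume w: "w \<in> PiE {..2 * p} ?D"
    then have "w 0 \<in> ?D 0" "w (2 * p) \<in> ?D (2 * p)" by (auto simp: PiE_iff)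
    then obtain i i' where i: "w 0 = Inl i" "i \<in> S" "w (2 * p) = Inl i'" by (auto simp: sides_def)
    have "(\<Sum>i\<in>S. of_bool (w 0 = Inl i) * case_sum (($) (axis i 1)) (\<lambda>_. 0) (w (2 * p)))
        = (\<Sum>l\<in>S. if l = i then of_bool (i' = i) else (0::real))"
      by (intro sum.cong refl) (auto simp: i axis_def)
    also have "\<dots> = of_bool (w (2 * p) = w 0)" using i by simp
    finally show "(\<Sum>i\<in>S. of_bool (w 0 = Inl i) * case_sum (($) (axis i 1)) (\<lambda>_. 0) (w (2 * p))) * (\<Prod>l<2 * p. x (edge (w l) (w (Suc l))))
      = (if w (2 * p) = w 0 then \<Prod>l<2 * p. x (edge (w l) (w (Suc l))) else 0)" by simp
  qed
  also have "\<dots> = (\<Sum>w\<in>{w \<in> PiE {..2 * p} (sides S T). w (2 * p) = w 0}. \<Prod>l<2 * p. x (edge (w l) (w (Suc l))))"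
    by (intro sum.inter_filter[symmetric] finite_PiE) (auto simp: sides_def)
  finally show ?thesis .
qed

text \<open>The identifications of walk positions forced by a pairing of the steps and by closing the walk:
  steps of equal parity are identified with the same orientation, steps of different parity with opposite ones.\<close>

definition identified :: "nat \<Rightarrow> (nat \<times> nat) list \<Rightarrow> (nat \<times> nat) set" where
  "identified p \<pi> = insert (2 * p, 0) (\<Union>(a, b)\<in>set \<pi>.
     if even a = even b then {(a, b), (Suc a, Suc b)} else {(a, Suc b), (Suc a, b)})"

lemma edge_eq_iff:
  assumes w: "\<And>k. k \<in> {a, Suc a, b, Suc b} \<Longrightarrow> w k \<in> sides S T k"
  shows "edge (w a) (w (Suc a)) = edge (w b) (w (Suc b)) \<longleftrightarrow>
    (if even a = even b then w a = w b \<and> w (Suc a) = w (Suc b) else w a = w (Suc b) \<and> w (Suc a) = w b)"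
  using w[of a] w[of "Suc a"] w[of b] w[of "Suc b"]
  by (cases "even a"; cases "even b") (auto simp: sides_def)

lemma walks_identified:
  assumes \<pi>: "matching_of [0..<2 * p] \<pi>"
  shows "walks (sides S T) (first_index (identified p \<pi>)) (2 * p)
    = {w \<in> PiE {..2 * p} (sides S T). w (2 * p) = w 0 \<and>
        (\<forall>(a, b)\<in>set \<pi>. edge (w a) (w (Suc a)) = edge (w b) (w (Suc b)))}"
proof -
  have lt: "a < 2 * p" "b < 2 * p" if "(a, b) \<in> set \<pi>" for a b
    using \<pi> that unfolding matching_of_def by (auto simp: set_eq_iff image_iff) (metis fst_conv snd_conv)+
  have sub: "identified p \<pi> \<subseteq> {..2 * p} \<times> {..2 * p}"
    using lt by (fastforce simp: identified_def split: if_splits)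
  have "(\<forall>(a, b)\<in>identified p \<pi>. w a = w b) \<longleftrightarrow> w (2 * p) = w 0 \<and>
        (\<forall>(a, b)\<in>set \<pi>. edge (w a) (w (Suc a)) = edge (w b) (w (Suc b)))"
    if w: "w \<in> PiE {..2 * p} (sides S T)" for w
  proof -
    have "edge (w a) (w (Suc a)) = edge (w b) (w (Suc b)) \<longleftrightarrow>
       (\<forall>(c, d)\<in>(if even a = even b then {(a, b), (Suc a, Suc b)} else {(a, Suc b), (Suc a, b)}). w c = w d)"
      if "(a, b) \<in> set \<pi>" for a b
      using w lt[OF that] by (subst edge_eq_iff[where S=S and T=T]) (auto simp: PiE_iff)
    then show ?thesis
      unfolding identified_def by fastforce
  qed
  then show ?thesis unfolding walks_first_index[OF sub] by blast
qed

lemma even_first_index_identified: "even (first_index (identified p \<pi>) k) = even k"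
  by (rule first_index_invariant) (auto simp: identified_def split: if_splits)

text \<open>A step that closes a pair retraverses an earlier edge, so it ends at a position already
  identified with an earlier one.\<close>

lemma new_position_opens:
  assumes \<pi>: "matching_of [0..<2 * p] \<pi>" and k: "k < 2 * p"
    and new: "first_index (identified p \<pi>) (Suc k) = Suc k"
  shows "k \<in> fst ` set \<pi>"
proof (rule ccontr)
  assume "k \<notin> fst ` set \<pi>"
  moreover have "k \<in> fst ` set \<pi> \<union> snd ` set \<pi>"
    using \<pi> k by (auto simp: matching_of_def)
  ultimately obtain a where a: "(a, k) \<in> set \<pi>" by auto
  then have "a < k" using \<pi> by (auto simp: matching_of_def)
  have "(Suc a, Suc k) \<in> identified p \<pi> \<or> (a, Suc k) \<in> identified p \<pi>"
    using a unfolding identified_def by (cases "even a = even k") force+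
  then have "first_index (identified p \<pi>) (Suc k) \<le> Suc a"
    by (metis first_index_eq first_index_le le_SucI)
  then show False using new \<open>a < k\<close> by simp
qed

lemma GE_trace_pairings:
  fixes g :: "'n::finite \<times> 'm::finite \<Rightarrow> 'a \<Rightarrow> real"
  assumes "gauss_family M g"
    and P: "\<And>\<pi>. \<pi> \<in> set P \<Longrightarrow> matching_of [0..<2 * p] \<pi>"
    and wick: "\<And>e :: nat \<Rightarrow> 'n \<times> 'm. wick (map e [0..<2 * p]) = (\<Sum>\<pi>\<leftarrow>P. if \<forall>(a, b)\<in>set \<pi>. e a = e b then 1 else 0)"
  shows "gauss_family.GE M g (\<lambda>x. \<Sum>i\<in>S. gform (submat S T (\<lambda>e. b e * x e)) p (axis i 1))
    = (\<Sum>\<pi>\<leftarrow>P. \<Sum>w\<in>walks (sides S T) (first_index (identified p \<pi>)) (2 * p).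
        \<Prod>k<2 * p. if k \<in> fst ` set \<pi> then (b (edge (w k) (w (Suc k))))\<^sup>2 else 1)"
proof -
  interpret gauss_family M g by fact
  let ?D = "sides S T" and ?e = "\<lambda>w k. edge (w k) (w (Suc k)) :: 'n \<times> 'm"
  let ?W = "{w \<in> PiE {..2 * p} ?D. w (2 * p) = w 0}"
  have prodl: "(\<Prod>l<2 * p. F l) = (\<Prod>l\<leftarrow>[0..<2 * p]. F l)" for F :: "nat \<Rightarrow> real"
    by (subst prod.distinct_set_conv_list[symmetric]) (auto simp: atLeast0LessThan)
  have finW: "finite ?W"
    by (rule finite_subset[OF _ finite_PiE[of "{..2*p}" ?D]]) (auto simp: sides_def)
  \<comment> \<open>Both steps of a pair use the same entry, so their two factors are collected as a
    square at the opening step.\<close>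
  have pair: "(\<Prod>l<2 * p. b (e l)) = (\<Prod>k<2 * p. if k \<in> fst ` set \<pi> then (b (e k))\<^sup>2 else 1)"
    if \<pi>: "matching_of [0..<2 * p] \<pi>" and e: "\<forall>(a, b)\<in>set \<pi>. e a = e b" for \<pi> and e :: "nat \<Rightarrow> 'n \<times> 'm"
  proof -
    have m: "distinct (map fst \<pi>)" "distinct (map snd \<pi>)" "set (map fst \<pi>) \<inter> set (map snd \<pi>) = {}"
      "{..<2 * p} = set (map fst \<pi>) \<union> set (map snd \<pi>)"
      using \<pi> by (auto simp: matching_of_def atLeast0LessThan)
    have "(\<Prod>l<2 * p. b (e l)) = (\<Prod>l\<in>set (map fst \<pi>). b (e l)) * (\<Prod>l\<in>set (map snd \<pi>). b (e l))"
      unfolding m(4) using m(3) by (intro prod.union_disjoint) auto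
    also have "\<dots> = (\<Prod>l\<leftarrow>map fst \<pi>. b (e l)) * (\<Prod>l\<leftarrow>map snd \<pi>. b (e l))"
      using m by (simp add: prod.distinct_set_conv_list del: set_map)
    also have "\<dots> = (\<Prod>l\<leftarrow>map fst \<pi>. (b (e l))\<^sup>2)"
      using e by (induction \<pi>) (auto simp: power2_eq_square ac_simps)
    also have "\<dots> = (\<Prod>l\<in>set (map fst \<pi>). (b (e l))\<^sup>2)"
      using m by (simp add: prod.distinct_set_conv_list del: set_map)
    also have "\<dots> = (\<Prod>l\<in>{k \<in> {..<2 * p}. k \<in> fst ` set \<pi>}. (b (e l))\<^sup>2)"
      using m(4) by (intro prod.cong) auto
    also have "\<dots> = (\<Prod>k<2 * p. if k \<in> fst ` set \<pi> then (b (e k))\<^sup>2 else 1)"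
      by (rule prod.inter_filter) simp
    finally show ?thesis .
  qed
  have "GE (\<lambda>x. \<Sum>i\<in>S. gform (submat S T (\<lambda>e. b e * x e)) p (axis i 1))
      = GE (\<lambda>x. \<Sum>w\<in>?W. (\<Prod>l<2 * p. b (?e w l)) * (\<Prod>e\<leftarrow>map (?e w) [0..<2 * p]. x e))"
    by (simp add: trace_gram_walks prod.distrib prodl comp_def)
  also have "\<dots> = (\<Sum>w\<in>?W. (\<Prod>l<2 * p. b (?e w l)) * wick (map (?e w) [0..<2 * p]))"
    by (subst GE_sum, intro polyf_intros) (simp only: GE_cmult GE_monomial)
  also have "\<dots> = (\<Sum>w\<in>?W. \<Sum>\<pi>\<leftarrow>P. if \<forall>(a, b)\<in>set \<pi>. ?e w a = ?e w b then \<Prod>l<2 * p. b (?e w l) else 0)"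
    unfolding wick sum_list_const_mult[symmetric] by (simp add: if_distrib cong: if_cong)
  also have "\<dots> = (\<Sum>\<pi>\<leftarrow>P. \<Sum>w\<in>?W. if \<forall>(a, b)\<in>set \<pi>. ?e w a = ?e w b then \<Prod>l<2 * p. b (?e w l) else 0)"
    by (induction P) (simp_all add: sum.distrib)
  also have "\<dots> = (\<Sum>\<pi>\<leftarrow>P. \<Sum>w\<in>walks ?D (first_index (identified p \<pi>)) (2 * p).
        \<Prod>k<2 * p. if k \<in> fst ` set \<pi> then (b (?e w k))\<^sup>2 else 1)"
  proof (rule arg_cong[where f=sum_list], rule map_cong[OF refl])
    fix \<pi> assume "\<pi> \<in> set P"
    then have m: "matching_of [0..<2 * p] \<pi>" by (rule P)
    have "(\<Sum>w\<in>?W. if \<forall>(a, b)\<in>set \<pi>. ?e w a = ?e w b then \<Prod>l<2 * p. b (?e w l) else 0)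
       = (\<Sum>w\<in>{w \<in> ?W. \<forall>(a, b)\<in>set \<pi>. ?e w a = ?e w b}. \<Prod>l<2 * p. b (?e w l))"
      by (rule sum.inter_filter[OF finW, symmetric])
    also have "{w \<in> ?W. \<forall>(a, b)\<in>set \<pi>. ?e w a = ?e w b} = walks ?D (first_index (identified p \<pi>)) (2 * p)"
      unfolding walks_identified[OF m] by auto
    also have "(\<Sum>w\<in>\<dots>. \<Prod>l<2 * p. b (?e w l)) = (\<Sum>w\<in>\<dots>. \<Prod>k<2 * p. if k \<in> fst ` set \<pi> then (b (?e w k))\<^sup>2 else 1)"
      unfolding walks_identified[OF m] by (intro sum.cong refl pair[OF m]) auto
    finally show "(\<Sum>w\<in>?W. if \<forall>(a, b)\<in>set \<pi>. ?e w a = ?e w b then \<Prod>l<2 * p. b (?e w l) else 0)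
       = (\<Sum>w\<in>walks ?D (first_index (identified p \<pi>)) (2 * p). \<Prod>k<2 * p. if k \<in> fst ` set \<pi> then (b (?e w k))\<^sup>2 else 1)" .
  qed
  finally show ?thesis .
qed

text \<open>For each pairing the product \<open>?c \<pi>\<close> bounds the cost for the weighted
  matrix and is exact for the standard one. Only the starting label differs, \<open>CARD('n)\<close>
  against \<open>card S\<close> choices, hence the cross-multiplied form.\<close>

lemma GE_trace_compare:
  fixes g :: "'n::finite \<times> 'm::finite \<Rightarrow> 'a \<Rightarrow> real" and S :: "'n set" and T :: "'m set"
  assumes gf: "gauss_family M g" and b: "\<And>e. \<bar>b e\<bar> \<le> 1"
    and row: "\<And>i. (\<Sum>j\<in>UNIV. (b (i, j))\<^sup>2) \<le> real (card T)"
    and col: "\<And>j. (\<Sum>i\<in>UNIV. (b (i, j))\<^sup>2) \<le> real (card S)"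
  shows "real (card S) * gauss_family.GE M g (\<lambda>x. \<Sum>i\<in>UNIV. gform (submat UNIV UNIV (\<lambda>e. b e * x e)) p (axis i 1))
    \<le> real CARD('n) * gauss_family.GE M g (\<lambda>x. \<Sum>i\<in>S. gform (submat S T x) p (axis i 1))"
proof -
  obtain P where P: "\<And>\<pi>. \<pi> \<in> set P \<Longrightarrow> matching_of [0..<2 * p] \<pi>"
    "\<And>e :: nat \<Rightarrow> 'n \<times> 'm. wick (map e [0..<2 * p]) = (\<Sum>\<pi>\<leftarrow>P. if \<forall>(a, b)\<in>set \<pi>. e a = e b then 1 else 0)"
    using wick_pairings[of "[0..<2 * p]", where 'e="'n \<times> 'm"] by auto
  let ?f = "\<lambda>\<pi>. first_index (identified p \<pi>)"
  let ?c = "\<lambda>\<pi>. \<Prod>k<2 * p. if ?f \<pi> (Suc k) = Suc k then real (card (sides S T (Suc k))) else 1"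
  have up: "(\<Sum>w\<in>walks (sides UNIV UNIV) (?f \<pi>) (2 * p). \<Prod>k<2 * p. if k \<in> fst ` set \<pi> then (b (edge (w k) (w (Suc k))))\<^sup>2 else 1)
      \<le> real CARD('n) * ?c \<pi>" if \<pi>: "\<pi> \<in> set P" for \<pi>
  proof -
    have 1: "(\<Sum>v\<in>sides UNIV UNIV (Suc k). if k \<in> fst ` set \<pi> then (b (edge u v))\<^sup>2 else 1) \<le> real (card (sides S T (Suc k)))"
      if "k < 2 * p" "?f \<pi> (Suc k) = Suc k" and u: "u \<in> sides UNIV UNIV k" for k u
    proof -
      have "k \<in> fst ` set \<pi>" using new_position_opens[OF P(1)[OF \<pi>] that(1,2)] .
      then have open_k: "(\<Sum>v\<in>sides UNIV UNIV (Suc k). if k \<in> fst ` set \<pi> then (b (edge u v))\<^sup>2 else 1)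
          = (\<Sum>v\<in>sides UNIV UNIV (Suc k). (b (edge u v))\<^sup>2)" by simp
      show ?thesis
      proof (cases "even k")
        case True
        then obtain i where "u = Inl i" using u by (auto simp: sides_def)
        then show ?thesis unfolding open_k using True row[of i]
          by (simp add: sum_sides) (simp add: sides_def card_image)
      next
        case False
        then obtain j where "u = Inr j" using u by (auto simp: sides_def)
        then show ?thesis unfolding open_k using False col[of j]
          by (simp add: sum_sides) (simp add: sides_def card_image)
      qed
    qed
    have "(\<Sum>w\<in>walks (sides UNIV UNIV) (?f \<pi>) (2 * p). \<Prod>k<2 * p. if k \<in> fst ` set \<pi> then (b (edge (w k) (w (Suc k))))\<^sup>2 else 1)
      \<le> real (card (sides (UNIV :: 'n set) (UNIV :: 'm set) 0)) * ?c \<pi>"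
      using b by (intro sum_walks_le[where wt="\<lambda>k u v. if k \<in> fst ` set \<pi> then (b (edge u v))\<^sup>2 else 1"
            and s="\<lambda>k. real (card (sides S T k))"] first_index_le 1)
        (auto simp: sides_def abs_square_le_1)
    then show ?thesis by (simp add: sides_def card_image)
  qed
  have ex: "real (card (walks (sides S T) (?f \<pi>) (2 * p))) = real (card S) * ?c \<pi>" for \<pi>
  proof -
    have "sides S T (?f \<pi> k) = sides S T k" for k
      by (simp add: sides_def even_first_index_identified)
    from card_walks[where f="?f \<pi>" and D="sides S T" and N="2 * p", OF first_index_le _ this] show ?thesis
      by (simp add: sides_def card_image)
  qed
  have "real (card S) * gauss_family.GE M g (\<lambda>x. \<Sum>i\<in>UNIV. gform (submat UNIV UNIV (\<lambda>e. b e * x e)) p (axis i 1))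
    \<le> real (card S) * (\<Sum>\<pi>\<leftarrow>P. real CARD('n) * ?c \<pi>)"
    by (subst GE_trace_pairings[OF gf P, where S=UNIV and T=UNIV and b=b], assumption)
       (intro mult_left_mono sum_list_mono up; simp)
  also have "\<dots> = real CARD('n) * (\<Sum>\<pi>\<leftarrow>P. real (card S) * ?c \<pi>)"
    by (simp add: sum_list_const_mult[symmetric] ac_simps)
  also have "\<dots> = real CARD('n) * gauss_family.GE M g (\<lambda>x. \<Sum>i\<in>S. gform (submat S T x) p (axis i 1))"
    using GE_trace_pairings[OF gf P, where S=S and T=T and b="\<lambda>_. 1"] by (simp add: ex cong: if_cong)
  finally show ?thesis .
qed

text \<open>The standard trace has \<open>d1\<close> diagonal entries, each with the Dyck bound, so
  the factor \<open>d1\<close> from the comparison cancels.\<close>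

lemma GE_trace_le:
  fixes g :: "'n::finite \<times> 'm::finite \<Rightarrow> 'a \<Rightarrow> real"
  assumes gf: "gauss_family M g" and p: "p \<ge> 1" and b: "\<And>e. \<bar>b e\<bar> \<le> 1"
    and row: "\<And>i. (\<Sum>j\<in>UNIV. (b (i, j))\<^sup>2) \<le> real d2"
    and col: "\<And>j. (\<Sum>i\<in>UNIV. (b (i, j))\<^sup>2) \<le> real d1"
    and d: "0 < d1" "d1 \<le> CARD('n)" "d2 \<le> CARD('m)"
  shows "gauss_family.GE M g (\<lambda>x. \<Sum>i\<in>UNIV. gform (submat UNIV UNIV (\<lambda>e. b e * x e)) p (axis i 1))
    \<le> real CARD('n) * (sqrt (real d2 + (2 * real p - 1)) + sqrt (real d1 + (2 * real p - 1))) ^ (2 * p)"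
    (is "?L \<le> _ * ?R")
proof -
  interpret gauss_family M g by fact
  obtain S :: "'n set" where S: "card S = d1" using d(2) by (metis obtain_subset_with_card_n)
  obtain T :: "'m set" where T: "card T = d2" using d(3) by (metis obtain_subset_with_card_n)
  have "real d1 * ?L \<le> real CARD('n) * GE (\<lambda>x. \<Sum>i\<in>S. gform (submat S T x) p (axis i 1))"
    using GE_trace_compare[OF gf b, where S=S and T=T and p=p] row col by (simp add: S T)
  also have "GE (\<lambda>x. \<Sum>i\<in>S. gform (submat S T x) p (axis i 1)) = (\<Sum>i\<in>S. GE (\<lambda>x. gform (submat S T x) p (axis i 1)))"
    by (intro GE_sum polyf_gform polyf_intros)
  also have "\<dots> \<le> (\<Sum>i\<in>S. ?R)"
    using GE_gform_axis_le[OF gf p, where S=S and T=T] by (intro sum_mono) (simp add: S T)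
  also have "\<dots> = real d1 * ?R" by (simp add: S)
  finally have "real d1 * ?L \<le> real d1 * (real CARD('n) * ?R)" by (simp add: mult_left_mono ac_simps)
  then show ?thesis using d(1) by simp
qed

section \<open>From moments to the spectral norm\<close>

lemma gform_1: "gform A (Suc 0) v = (norm (transpose A *v v))\<^sup>2"
  by (simp add: gform_def gram_def inner_matrix_vector power2_norm_eq_inner del: transpose_matrix_vector)

lemma gform_double: "gform A (k + k) v = (norm ((gram A ^^ k) v))\<^sup>2"
  by (simp add: gform_def funpow_add inner_gram_power power2_norm_eq_inner)

text \<open>Repeated squaring: by Cauchy-Schwarz, the square of the form of order \<open>k\<close>
  at a unit vector is at most the form of order \<open>2 * k\<close>.\<close>

lemma gform_power_two:
  assumes "norm v = 1"
  shows "gform A (Suc 0) v ^ (2 ^ r) \<le> gform A (2 ^ r) v"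
proof (induction r)
  case (Suc r)
  have "gform A (Suc 0) v ^ (2 ^ Suc r) = (gform A (Suc 0) v ^ (2 ^ r))\<^sup>2"
    by (simp only: power_Suc mult.commute[of 2] power_mult)
  also have "\<dots> \<le> (gform A (2 ^ r) v)\<^sup>2"
    using Suc by (intro power_mono) (simp_all add: gform_1)
  also have "\<dots> \<le> (norm ((gram A ^^ 2 ^ r) v))\<^sup>2"
  proof (rule abs_le_square_iff[THEN iffD1])
    show "\<bar>gform A (2 ^ r) v\<bar> \<le> \<bar>norm ((gram A ^^ 2 ^ r) v)\<bar>"
      unfolding gform_def using Cauchy_Schwarz_ineq2[of v "(gram A ^^ 2 ^ r) v"] assms by simp
  qed
  also have "\<dots> = gform A (2 ^ Suc r) v"
    by (simp add: gform_double[symmetric] mult_2)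
  finally show ?case .
qed simp

lemma norm_sq_le_columns:
  fixes v :: "real^'n::finite" and w :: "real^'k::finite"
  assumes "norm v = 1" "\<And>i. w $ i = u i \<bullet> v"
  shows "(norm w)\<^sup>2 \<le> (\<Sum>i\<in>UNIV. (norm (u i))\<^sup>2)"
proof -
  have "(norm w)\<^sup>2 = (\<Sum>i\<in>UNIV. (u i \<bullet> v)\<^sup>2)"
    unfolding power2_norm_eq_inner inner_vec_def[of w w] by (simp add: assms(2) power2_eq_square)
  also have "\<dots> \<le> (\<Sum>i\<in>UNIV. (norm (u i))\<^sup>2)"
  proof (intro sum_mono)
    fix i show "(u i \<bullet> v)\<^sup>2 \<le> (norm (u i))\<^sup>2"
      using Cauchy_Schwarz_ineq2[of "u i" v] assms(1)
      by (intro abs_le_square_iff[THEN iffD1]) simp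
  qed
  finally show ?thesis .
qed

text \<open>The exponent \<open>Suc r\<close> leaves a half power \<open>2 ^ r\<close>: the trace is
  the squared Frobenius norm of that power, which dominates its action on a unit vector.\<close>

lemma norm_power_le_trace:
  fixes A :: "real^'m::finite^'n::finite"
  assumes "norm v = 1"
  shows "norm (transpose A *v v) ^ (2 * 2 ^ Suc r) \<le> (\<Sum>i\<in>UNIV. gform A (2 ^ Suc r) (axis i 1))"
proof -
  have "norm (transpose A *v v) ^ (2 * 2 ^ Suc r) = gform A (Suc 0) v ^ (2 ^ Suc r)"
    by (simp only: gform_1 power_mult)
  also have "\<dots> \<le> gform A (2 ^ Suc r) v" by (rule gform_power_two[OF assms])
  also have "\<dots> = (norm ((gram A ^^ 2 ^ r) v))\<^sup>2"
    by (simp add: gform_double[symmetric] mult_2)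
  also have "\<dots> \<le> (\<Sum>i\<in>UNIV. (norm ((gram A ^^ 2 ^ r) (axis i 1)))\<^sup>2)"
    using assms by (intro norm_sq_le_columns[where v=v])
      (simp_all add: inner_gram_power[symmetric] inner_axis')
  also have "\<dots> = (\<Sum>i\<in>UNIV. gform A (2 ^ Suc r) (axis i 1))"
    by (simp add: gform_double[symmetric] mult_2)
  finally show ?thesis .
qed

lemma norm_sq_le_frobenius:
  fixes A :: "real^'m::finite^'n::finite"
  assumes "norm v = 1"
  shows "(norm (transpose A *v v))\<^sup>2 \<le> (\<Sum>i\<in>UNIV. \<Sum>j\<in>UNIV. (A $ i $ j)\<^sup>2)"
proof -
  have "(norm (transpose A *v v))\<^sup>2 \<le> (\<Sum>j\<in>UNIV. (norm (column j A))\<^sup>2)"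
    using assms by (intro norm_sq_le_columns[where v=v])
      (auto simp: matrix_vector_mult_def transpose_def column_def inner_vec_def)
  also have "\<dots> = (\<Sum>j\<in>UNIV. \<Sum>i\<in>UNIV. (A $ i $ j)\<^sup>2)"
    unfolding power2_norm_eq_inner inner_vec_def column_def by (simp add: power2_eq_square)
  finally show ?thesis by (subst sum.swap)
qed

lemma spectral_norm_le_transpose:
  fixes A :: "real^'m::finite^'n::finite"
  assumes c: "\<And>v. norm v = 1 \<Longrightarrow> norm (transpose A *v v) \<le> c"
  shows "spectral_norm A \<le> c"
proof -
  have "0 \<le> c" using c[of "axis undefined 1"] by (meson norm_axis_1 norm_ge_zero order_trans)
  have t: "norm (transpose A *v v) \<le> c * norm v" for v
  proof (cases "v = 0")
    case False
    have "norm (transpose A *v (v /\<^sub>R norm v)) \<le> c" using False by (intro c) simp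
    then show ?thesis using False by (simp add: matrix_vector_mult_scaleR field_simps del: transpose_matrix_vector)
  qed (simp del: transpose_matrix_vector)
  show ?thesis
    unfolding spectral_norm_def
  proof (rule onorm_bound[OF \<open>0 \<le> c\<close>])
    fix y
    have "(norm (A *v y))\<^sup>2 = (transpose A *v (A *v y)) \<bullet> y"
      by (simp add: power2_norm_eq_inner inner_matrix_vector del: transpose_matrix_vector)
    also have "\<dots> \<le> norm (transpose A *v (A *v y)) * norm y" by (rule norm_cauchy_schwarz)
    also have "\<dots> \<le> c * norm (A *v y) * norm y" by (intro mult_right_mono t) simp
    finally have "norm (A *v y) * norm (A *v y) \<le> norm (A *v y) * (c * norm y)"
      by (simp add: power2_eq_square ac_simps)
    then show "norm (A *v y) \<le> c * norm y"
      using \<open>0 \<le> c\<close> by (cases "A *v y = 0") auto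
  qed
qed

text \<open>Bernoulli's inequality linearizes the \<open>N\<close>-th root, so that the bound can be integrated directly.\<close>

lemma spectral_norm_le_power:
  fixes A :: "real^'m::finite^'n::finite"
  assumes K: "0 < K" and N: "0 < N"
    and t: "\<And>v. norm v = 1 \<Longrightarrow> norm (transpose A *v v) ^ N \<le> t"
  shows "spectral_norm A \<le> K + K / real N * (t / K ^ N - 1)"
proof (rule spectral_norm_le_transpose)
  fix v :: "real^'n" assume v: "norm v = 1"
  define s where "s = norm (transpose A *v v) / K"
  have "1 + real N * (s - 1) \<le> s ^ N"
    using Bernoulli_inequality[of "s - 1" N] K by (simp add: s_def)
  also have "\<dots> \<le> t / K ^ N"
    using t[OF v] K by (simp add: s_def power_divide divide_right_mono)
  finally have "s \<le> 1 + (t / K ^ N - 1) / real N"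
    using N by (simp add: field_simps)
  then have "K * s \<le> K * (1 + (t / K ^ N - 1) / real N)"
    using K by (intro mult_left_mono) auto
  then show "norm (transpose A *v v) \<le> K + K / real N * (t / K ^ N - 1)"
    using K by (simp add: s_def distrib_left del: transpose_matrix_vector)
qed

lemma spectral_norm_nonneg: "0 \<le> spectral_norm A"
  by (simp add: spectral_norm_def onorm_pos_le matrix_vector_mul_bounded_linear)

lemma spectral_norm_scaleR: "spectral_norm (c *\<^sub>R A) = \<bar>c\<bar> * spectral_norm A"
proof -
  have "(*v) (c *\<^sub>R A) = (\<lambda>y. c *\<^sub>R (A *v y))"
    by (rule ext) (simp add: scaleR_matrix_vector_assoc)
  then show ?thesis
    by (simp add: spectral_norm_def onorm_scaleR matrix_vector_mul_bounded_linear)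
qed

lemma spectral_norm_0 [simp]: "spectral_norm 0 = 0"
  using spectral_norm_scaleR[of 0 0] by simp

lemma spectral_norm_transpose_le:
  fixes A :: "real^'m::finite^'n::finite"
  shows "spectral_norm A \<le> spectral_norm (transpose A)"
proof (rule spectral_norm_le_transpose)
  fix v :: "real^'n" assume "norm v = 1"
  then show "norm (transpose A *v v) \<le> spectral_norm (transpose A)"
    unfolding spectral_norm_def
    using onorm[OF matrix_vector_mul_bounded_linear[of "transpose A"], of v] by simp
qed

section \<open>Normalization, choice of the moment order and the final bound\<close>

definition hadamard :: "real^'m::finite^'n::finite \<Rightarrow> ('n \<times> 'm \<Rightarrow> real) \<Rightarrow> real^'m^'n" where
  "hadamard b x = (\<chi> i j. x (i, j) * b $ i $ j)"

lemma hadamard_submat: "hadamard b x = submat UNIV UNIV (\<lambda>e. b $ fst e $ snd e * x e)"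
  by (simp add: hadamard_def submat_def vec_eq_iff)

lemma sigma_star_ge: "\<bar>b $ i $ j\<bar> \<le> sigma_star b"
  unfolding sigma_star_def by (rule Max_ge) (auto intro!: image_eqI[of _ _ "(i, j)"])

lemma sigma_star_nonneg: "0 \<le> sigma_star b"
  using sigma_star_ge[of b undefined undefined] by linarith

lemma sigma_row_ge: "(\<Sum>j\<in>UNIV. (b $ i $ j)\<^sup>2) \<le> (sigma_row b)\<^sup>2" "0 \<le> sigma_row b"
proof -
  have le: "sqrt (\<Sum>j\<in>UNIV. (b $ i $ j)\<^sup>2) \<le> sigma_row b" for i
    unfolding sigma_row_def by (rule Max_ge) auto
  have s0: "0 \<le> (\<Sum>j\<in>UNIV. (b $ i $ j)\<^sup>2)" for i by (simp add: sum_nonneg)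
  show "0 \<le> sigma_row b" using le[of undefined] real_sqrt_ge_zero[OF s0[of undefined]] by linarith
  then show "(\<Sum>j\<in>UNIV. (b $ i $ j)\<^sup>2) \<le> (sigma_row b)\<^sup>2"
    using le[of i] sqrt_le_D by blast
qed

lemma sigma_transpose:
  "sigma_row (transpose b) = sigma_col b" "sigma_col (transpose b) = sigma_row b"
  "sigma_star (transpose b) = sigma_star b"
proof -
  show "sigma_row (transpose b) = sigma_col b" "sigma_col (transpose b) = sigma_row b"
    by (simp_all add: sigma_row_def sigma_col_def transpose_def)
  have "range (\<lambda>p. \<bar>transpose b $ fst p $ snd p\<bar>) = (\<lambda>p. \<bar>b $ fst p $ snd p\<bar>) ` range prod.swap"
    unfolding image_image by (simp add: transpose_def)
  then show "sigma_star (transpose b) = sigma_star b" by (simp add: sigma_star_def)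
qed

lemma sigma_col_ge: "(\<Sum>i\<in>UNIV. (b $ i $ j)\<^sup>2) \<le> (sigma_col b)\<^sup>2" "0 \<le> sigma_col b"
  using sigma_row_ge[of "transpose b"] by (simp_all add: sigma_transpose) (simp add: transpose_def)

lemma sqrt_add_le: "0 \<le> s \<Longrightarrow> 0 \<le> t \<Longrightarrow> sqrt (s\<^sup>2 + t) \<le> s + sqrt t"
  by (rule real_le_lsqrt) (simp_all add: power2_sum)

text \<open>The majorant is affine in the trace, hence a polynomial, so its integrability and
  integral come from the moment calculus and measurability of the spectral norm never
  arises.\<close>

lemma spectral_norm_majorant:
  fixes b :: "real^'m::finite^'n::finite" and g :: "'n \<times> 'm \<Rightarrow> 'a \<Rightarrow> real"
  assumes gf: "gauss_family M g" and b1: "\<And>i j. \<bar>b $ i $ j\<bar> \<le> 1"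
    and s: "0 \<le> s1" "0 \<le> s2"
    and row: "\<And>i. (\<Sum>j\<in>UNIV. (b $ i $ j)\<^sup>2) \<le> s1\<^sup>2"
    and col: "\<And>j. (\<Sum>i\<in>UNIV. (b $ i $ j)\<^sup>2) \<le> s2\<^sup>2"
    and p: "p = 2 ^ Suc r"
  shows "\<exists>h. integrable M h \<and> (\<forall>\<omega>. spectral_norm (hadamard b (\<lambda>e. g e \<omega>)) \<le> h \<omega>) \<and>
    (\<integral>\<omega>. h \<omega> \<partial>M) \<le> real CARD('n) powr (1 / (2 * real p)) * (s1 + s2 + 2 * sqrt (2 * real p))"
proof -
  interpret gauss_family M g by fact
  have p1: "p \<ge> 1" by (simp add: p)
  \<comment> \<open>The caps guarantee index subsets of these sizes and cost nothing, since entries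
    bounded by 1 bound the row and column sums as well. The \<open>max 1\<close> keeps
    \<open>d1\<close> positive for cancellation.\<close>
  define d2 where "d2 = min CARD('m) (nat \<lceil>s1\<^sup>2\<rceil>)"
  define d1 where "d1 = min CARD('n) (max 1 (nat \<lceil>s2\<^sup>2\<rceil>))"
  have b2: "(b $ i $ j)\<^sup>2 \<le> 1" for i j using b1[of i j] by (simp add: abs_square_le_1)
  have row': "(\<Sum>j\<in>UNIV. (b $ i $ j)\<^sup>2) \<le> real d2" for i
  proof -
    have "(\<Sum>j\<in>UNIV. (b $ i $ j)\<^sup>2) \<le> real CARD('m)"
      using sum_mono[of "UNIV :: 'm set" "\<lambda>j. (b $ i $ j)\<^sup>2" "\<lambda>_. 1"] b2 by simp
    moreover have "s1\<^sup>2 \<le> real (nat \<lceil>s1\<^sup>2\<rceil>)" by linarith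
    ultimately show ?thesis using row[of i] unfolding d2_def of_nat_min by (intro min.boundedI) linarith+
  qed
  have col': "(\<Sum>i\<in>UNIV. (b $ i $ j)\<^sup>2) \<le> real d1" for j
  proof -
    have "(\<Sum>i\<in>UNIV. (b $ i $ j)\<^sup>2) \<le> real CARD('n)"
      using sum_mono[of "UNIV :: 'n set" "\<lambda>i. (b $ i $ j)\<^sup>2" "\<lambda>_. 1"] b2 by simp
    moreover have "s2\<^sup>2 \<le> real (max 1 (nat \<lceil>s2\<^sup>2\<rceil>))" by linarith
    ultimately show ?thesis using col[of j] unfolding d1_def of_nat_min by (intro min.boundedI) linarith+
  qed
  have d: "0 < d1" "d1 \<le> CARD('n)" "d2 \<le> CARD('m)" by (auto simp: d1_def d2_def)
  have d_le: "real d2 \<le> s1\<^sup>2 + 1" "real d1 \<le> s2\<^sup>2 + 1"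
  proof -
    have "real d2 \<le> real (nat \<lceil>s1\<^sup>2\<rceil>)" "real d1 \<le> real (max 1 (nat \<lceil>s2\<^sup>2\<rceil>))"
      by (simp_all only: d1_def d2_def of_nat_le_iff min.cobounded2)
    moreover have "real (nat \<lceil>s1\<^sup>2\<rceil>) \<le> s1\<^sup>2 + 1" "real (nat \<lceil>s2\<^sup>2\<rceil>) \<le> s2\<^sup>2 + 1"
      using zero_le_power2[of s1] zero_le_power2[of s2] by linarith+
    moreover have "0 \<le> s2\<^sup>2" by simp
    ultimately show "real d2 \<le> s1\<^sup>2 + 1" "real d1 \<le> s2\<^sup>2 + 1" by linarith+
  qed
  define \<Lambda> where "\<Lambda> = sqrt (real d2 + (2 * real p - 1)) + sqrt (real d1 + (2 * real p - 1))"
  have \<Lambda>_pos: "0 < \<Lambda>" using p1 by (simp add: \<Lambda>_def add_nonneg_pos)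
  have \<Lambda>_le: "\<Lambda> \<le> s1 + s2 + 2 * sqrt (2 * real p)"
  proof -
    \<comment> \<open>The rounding error of at most 1 cancels against the
      \<open>- 1\<close>.\<close>
    have "sqrt (real d2 + (2 * real p - 1)) \<le> s1 + sqrt (2 * real p)"
      using d_le s by (intro order_trans[OF _ sqrt_add_le]) auto
    moreover have "sqrt (real d1 + (2 * real p - 1)) \<le> s2 + sqrt (2 * real p)"
      using d_le s by (intro order_trans[OF _ sqrt_add_le]) auto
    ultimately show ?thesis by (simp add: \<Lambda>_def)
  qed
  define K where "K = real CARD('n) powr (1 / (2 * real p)) * \<Lambda>"
  have K: "0 < K" using \<Lambda>_pos by (simp add: K_def)
  have K_pow: "K ^ (2 * p) = real CARD('n) * \<Lambda> ^ (2 * p)"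
    using p1 by (simp add: K_def power_mult_distrib powr_powr flip: powr_realpow)
  define Tr where "Tr x = (\<Sum>i\<in>UNIV. gform (submat UNIV UNIV (\<lambda>e. b $ fst e $ snd e * x e)) p (axis i 1 :: real^'n))" for x
  have polyTr: "polyf Tr"
    unfolding Tr_def[abs_def] by (intro polyf_intros polyf_gform)
  have Tr_le: "GE Tr \<le> K ^ (2 * p)"
    unfolding K_pow \<Lambda>_def Tr_def[abs_def]
    by (rule GE_trace_le[OF gf p1, where b="\<lambda>e. b $ fst e $ snd e"]) (use b1 row' col' d in auto)
  \<comment> \<open>Tuned to the moment bound: as \<open>GE Tr \<le> K ^ (2 * p)\<close>, the
    correction has nonpositive expectation and only \<open>K\<close> remains.\<close>
  define h where "h x = K + K / real (2 * p) * (Tr x / K ^ (2 * p) - 1)" for x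
  have "integrable M (\<lambda>\<omega>. h (\<lambda>e. g e \<omega>))"
    unfolding h_def using integrable_polyf[OF polyTr] by simp
  moreover have "spectral_norm (hadamard b x) \<le> h x" for x
    unfolding h_def hadamard_submat Tr_def
    using p1 norm_power_le_trace unfolding p by (intro spectral_norm_le_power K[unfolded p]) auto
  moreover have "(\<integral>\<omega>. h (\<lambda>e. g e \<omega>) \<partial>M) = K + K / real (2 * p) * (GE Tr / K ^ (2 * p) - 1)"
    unfolding h_def GE_def using integrable_polyf[OF polyTr] by (simp add: prob_space)
  moreover have "GE Tr / K ^ (2 * p) - 1 \<le> 0"
    using Tr_le K by simp
  then have "K + K / real (2 * p) * (GE Tr / K ^ (2 * p) - 1) \<le> K"
    using mult_nonneg_nonpos[of "K / real (2 * p)" "GE Tr / K ^ (2 * p) - 1"] K by simp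
  moreover have "K \<le> real CARD('n) powr (1 / (2 * real p)) * (s1 + s2 + 2 * sqrt (2 * real p))"
    unfolding K_def by (intro mult_left_mono \<Lambda>_le) simp
  ultimately show ?thesis by (intro exI[of _ "\<lambda>\<omega>. h (\<lambda>e. g e \<omega>)"]) auto
qed

lemma spectral_norm_majorant_sigma:
  fixes b :: "real^'m::finite^'n::finite" and g :: "'n \<times> 'm \<Rightarrow> 'a \<Rightarrow> real"
  assumes gf: "gauss_family M g" and p: "p = 2 ^ Suc r"
  shows "\<exists>h. integrable M h \<and> (\<forall>\<omega>. spectral_norm (hadamard b (\<lambda>e. g e \<omega>)) \<le> h \<omega>) \<and>
    (\<integral>\<omega>. h \<omega> \<partial>M) \<le> real CARD('n) powr (1 / (2 * real p))
      * (sigma_row b + sigma_col b + 2 * sqrt (2 * real p) * sigma_star b)"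
proof (cases "sigma_star b = 0")
  case True
  then have "b $ i $ j = 0" for i j using sigma_star_ge[of b i j] by simp
  then have "hadamard b x = 0" for x by (simp add: hadamard_def vec_eq_iff)
  then show ?thesis
    using sigma_row_ge(2)[of b] sigma_col_ge(2)[of b] by (intro exI[of _ "\<lambda>_. 0"]) (simp add: True)
next
  case False
  define c where "c = sigma_star b"
  have c: "0 < c" using False sigma_star_nonneg[of b] by (simp add: c_def)
  define b' where "b' = (1 / c) *\<^sub>R b"
  have b': "b' $ i $ j = b $ i $ j / c" for i j by (simp add: b'_def)
  have "\<bar>b' $ i $ j\<bar> \<le> 1" for i j
    using sigma_star_ge[of b i j] c by (simp add: b' c_def[symmetric])
  moreover have "(\<Sum>j\<in>UNIV. (b' $ i $ j)\<^sup>2) \<le> (sigma_row b / c)\<^sup>2" for i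
    using sigma_row_ge(1)[of b i] c by (simp add: b' power_divide sum_divide_distrib[symmetric] divide_right_mono)
  moreover have "(\<Sum>i\<in>UNIV. (b' $ i $ j)\<^sup>2) \<le> (sigma_col b / c)\<^sup>2" for j
    using sigma_col_ge(1)[of b j] c by (simp add: b' power_divide sum_divide_distrib[symmetric] divide_right_mono)
  ultimately obtain h where h: "integrable M h" "\<And>\<omega>. spectral_norm (hadamard b' (\<lambda>e. g e \<omega>)) \<le> h \<omega>"
    "(\<integral>\<omega>. h \<omega> \<partial>M) \<le> real CARD('n) powr (1 / (2 * real p)) * (sigma_row b / c + sigma_col b / c + 2 * sqrt (2 * real p))"
    using spectral_norm_majorant[OF gf, of b' "sigma_row b / c" "sigma_col b / c" p r] p c
      sigma_row_ge(2)[of b] sigma_col_ge(2)[of b] by auto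
  have "hadamard b x = c *\<^sub>R hadamard b' x" for x
    using c by (simp add: hadamard_def b' vec_eq_iff)
  then have "spectral_norm (hadamard b (\<lambda>e. g e \<omega>)) \<le> c * h \<omega>" for \<omega>
    using h(2)[of \<omega>] c by (simp add: spectral_norm_scaleR)
  moreover have "(\<integral>\<omega>. c * h \<omega> \<partial>M) \<le> real CARD('n) powr (1 / (2 * real p))
      * (sigma_row b + sigma_col b + 2 * sqrt (2 * real p) * sigma_star b)"
  proof -
    have "(\<integral>\<omega>. c * h \<omega> \<partial>M) = c * (\<integral>\<omega>. h \<omega> \<partial>M)" by simp
    also have "\<dots> \<le> c * (real CARD('n) powr (1 / (2 * real p)) * (sigma_row b / c + sigma_col b / c + 2 * sqrt (2 * real p)))"
      using h(3) c by (intro mult_left_mono) auto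
    also have "\<dots> = real CARD('n) powr (1 / (2 * real p)) * (sigma_row b + sigma_col b + 2 * sqrt (2 * real p) * c)"
      using c by (simp add: field_simps)
    finally show ?thesis by (simp add: c_def)
  qed
  ultimately show ?thesis using h(1) by (intro exI[of _ "\<lambda>\<omega>. c * h \<omega>"]) auto
qed

text \<open>The logarithmic term vanishes here and cannot pay for the term in \<open>sqrt p\<close>.
  The second moment of the Frobenius norm, a single row sum, gives \<open>sigma_row b\<close>
  directly.\<close>

lemma spectral_norm_majorant_one_row:
  fixes b :: "real^'m::finite^'n::finite" and g :: "'n \<times> 'm \<Rightarrow> 'a \<Rightarrow> real"
  assumes gf: "gauss_family M g" and n: "CARD('n) = 1"
  shows "\<exists>h. integrable M h \<and> (\<forall>\<omega>. spectral_norm (hadamard b (\<lambda>e. g e \<omega>)) \<le> h \<omega>) \<and>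
    (\<integral>\<omega>. h \<omega> \<partial>M) \<le> sigma_row b"
proof (cases "sigma_row b = 0")
  case True
  have "(b $ i $ j)\<^sup>2 \<le> 0" for i j
  proof -
    have "(b $ i $ j)\<^sup>2 \<le> (\<Sum>j\<in>UNIV. (b $ i $ j)\<^sup>2)"
      by (rule member_le_sum) auto
    also have "\<dots> \<le> 0"
      using sigma_row_ge(1)[of b i] True by simp
    finally show ?thesis .
  qed
  then have "hadamard b x = 0" for x by (simp add: hadamard_def vec_eq_iff)
  then show ?thesis by (intro exI[of _ "\<lambda>_. 0"]) (simp add: True)
next
  case False
  interpret gauss_family M g by fact
  define K where "K = sigma_row b"
  have K: "0 < K" using False sigma_row_ge(2)[of b] by (simp add: K_def)
  define F where "F x = (\<Sum>i\<in>UNIV. \<Sum>j\<in>UNIV. (hadamard b x $ i $ j)\<^sup>2)" for x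
  have F: "F x = (\<Sum>i\<in>UNIV. \<Sum>j\<in>UNIV. (b $ i $ j)\<^sup>2 * (x (i, j))\<^sup>2)" for x
    by (simp add: F_def hadamard_def power_mult_distrib mult.commute)
  have polyF: "polyf F" unfolding F[abs_def] by (intro polyf_intros)
  have sq: "GE (\<lambda>x. (x e)\<^sup>2) = 1" for e
    using GE_power_sum_squares[of "{e}" 1] by simp
  have "GE F = (\<Sum>i\<in>UNIV. \<Sum>j\<in>UNIV. (b $ i $ j)\<^sup>2)"
    unfolding F[abs_def] by (simp add: GE_sum GE_cmult sq polyf_intros)
  also have "\<dots> \<le> (\<Sum>i\<in>(UNIV :: 'n set). K\<^sup>2)"
    unfolding K_def by (intro sum_mono sigma_row_ge)
  finally have F_le: "GE F \<le> K\<^sup>2" by (simp add: n)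
  define h where "h x = K + K / real 2 * (F x / K ^ 2 - 1)" for x
  have "integrable M (\<lambda>\<omega>. h (\<lambda>e. g e \<omega>))"
    unfolding h_def using integrable_polyf[OF polyF] by simp
  moreover have "spectral_norm (hadamard b x) \<le> h x" for x
    unfolding h_def F_def using norm_sq_le_frobenius by (intro spectral_norm_le_power K) auto
  moreover have "(\<integral>\<omega>. h (\<lambda>e. g e \<omega>) \<partial>M) = K + K / real 2 * (GE F / K ^ 2 - 1)"
    unfolding h_def GE_def using integrable_polyf[OF polyF] by (simp add: prob_space)
  moreover have "GE F / K ^ 2 - 1 \<le> 0"
    using F_le K by simp
  then have "K + K / real 2 * (GE F / K ^ 2 - 1) \<le> K"
    using K by (simp add: mult_nonneg_nonpos)
  ultimately show ?thesis by (intro exI[of _ "\<lambda>\<omega>. h (\<lambda>e. g e \<omega>)"]) (auto simp: K_def)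
qed

text \<open>The first condition says \<open>p \<ge> y\<close>. The least power of two above
  \<open>y\<close> is at most \<open>2 * y\<close>, and the doubling in \<open>Suc r\<close>
  required by \<open>norm_power_le_trace\<close> gives \<open>p \<le> 4 * y\<close>. This yields the
  constant 4, within the stated 5.\<close>

lemma moment_order_exists:
  fixes n :: nat and \<epsilon> :: real
  assumes n: "2 \<le> n" and \<epsilon>: "0 < \<epsilon>" "\<epsilon> \<le> 1 / 2"
  obtains r where "real n powr (1 / (2 * real (2 ^ Suc r))) \<le> 1 + \<epsilon>"
    and "2 * sqrt (2 * real (2 ^ Suc r)) \<le> 5 / sqrt (ln (1 + \<epsilon>)) * sqrt (ln (real n))"
proof -
  define l where "l = ln (1 + \<epsilon>)"
  define y where "y = ln (real n) / (2 * l)"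
  have l: "0 < l" using \<epsilon> by (simp add: l_def)
  \<comment> \<open>Here \<open>1 + \<epsilon> < 2 \<le> n\<close>. The resulting
    \<open>1 / 2 < y\<close> covers the case \<open>r = 0\<close> of
    \<open>2 ^ r \<le> 2 * y\<close>.\<close>
  have "l < ln (real n)" using n \<epsilon> unfolding l_def by (subst ln_less_cancel_iff) auto
  then have y: "1 / 2 < y" using l by (simp add: y_def field_simps)
  obtain r0 where "y < 2 ^ r0" using real_arch_pow[of 2 y] by auto
  define r where "r = (LEAST r. y \<le> 2 ^ r)"
  have r: "y \<le> 2 ^ r" unfolding r_def by (rule LeastI[of _ r0]) (use \<open>y < 2 ^ r0\<close> in simp)
  have r2: "2 ^ r \<le> 2 * y"
  proof (cases r)
    case (Suc k)
    have "\<not> y \<le> 2 ^ k" using not_less_Least[of k "\<lambda>r. y \<le> 2 ^ r"] Suc by (simp add: r_def)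
    then show ?thesis by (simp add: Suc)
  qed (use y in simp)
  define p where "p = real (2 ^ Suc r)"
  have p: "y \<le> p" "p \<le> 4 * y" "0 < p" using r r2 y by (auto simp: p_def)
  show ?thesis
  proof (rule that[of r])
    have "ln (real n) / (2 * p) \<le> l"
      using p l by (simp add: y_def field_simps)
    then have "exp (ln (real n) / (2 * p)) \<le> exp l" by simp
    then show "real n powr (1 / (2 * real (2 ^ Suc r))) \<le> 1 + \<epsilon>"
      using n \<epsilon> unfolding p_def[symmetric] by (simp add: powr_def l_def)
  next
    have "2 * sqrt (2 * p) \<le> 2 * sqrt (2\<^sup>2 * (ln (real n) / l))"
      using p l by (simp add: y_def)
    also have "\<dots> = 4 * (sqrt (ln (real n)) / sqrt l)"
      by (simp only: real_sqrt_mult real_sqrt_divide real_sqrt_abs)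
    also have "\<dots> \<le> 5 * (sqrt (ln (real n)) / sqrt l)"
      using n l by (intro mult_right_mono) auto
    finally show "2 * sqrt (2 * real (2 ^ Suc r)) \<le> 5 / sqrt (ln (1 + \<epsilon>)) * sqrt (ln (real n))"
      by (simp add: p_def l_def)
  qed
qed

lemma spectral_norm_majorant_rows:
  fixes b :: "real^'m::finite^'n::finite" and g :: "'n \<times> 'm \<Rightarrow> 'a \<Rightarrow> real"
  assumes gf: "gauss_family M g" and \<epsilon>: "0 < \<epsilon>" "\<epsilon> \<le> 1 / 2"
  shows "\<exists>h. integrable M h \<and> (\<forall>\<omega>. spectral_norm (hadamard b (\<lambda>e. g e \<omega>)) \<le> h \<omega>) \<and>
    (\<integral>\<omega>. h \<omega> \<partial>M) \<le> (1 + \<epsilon>) * (sigma_row b + sigma_col b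
         + 5 / sqrt (ln (1 + \<epsilon>)) * sigma_star b * sqrt (ln (real CARD('n))))"
proof (cases "CARD('n) = 1")
  case True
  have "0 \<le> \<epsilon> * sigma_row b + (1 + \<epsilon>) * sigma_col b"
    using \<epsilon> sigma_row_ge(2)[of b] sigma_col_ge(2)[of b] by simp
  then have "sigma_row b \<le> (1 + \<epsilon>) * (sigma_row b + sigma_col b
         + 5 / sqrt (ln (1 + \<epsilon>)) * sigma_star b * sqrt (ln (real CARD('n))))"
    by (simp add: True algebra_simps)
  then show ?thesis using spectral_norm_majorant_one_row[OF gf True, of b] order_trans by blast
next
  case False
  then have n: "2 \<le> CARD('n)" using zero_less_card_finite[where 'a='n] by linarith
  obtain r where r: "real CARD('n) powr (1 / (2 * real (2 ^ Suc r))) \<le> 1 + \<epsilon>"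
    "2 * sqrt (2 * real (2 ^ Suc r)) \<le> 5 / sqrt (ln (1 + \<epsilon>)) * sqrt (ln (real CARD('n)))"
    using moment_order_exists[OF n \<epsilon>] by blast
  have "real CARD('n) powr (1 / (2 * real (2 ^ Suc r)))
      * (sigma_row b + sigma_col b + 2 * sqrt (2 * real (2 ^ Suc r)) * sigma_star b)
    \<le> (1 + \<epsilon>) * (sigma_row b + sigma_col b
      + (5 / sqrt (ln (1 + \<epsilon>)) * sqrt (ln (real CARD('n)))) * sigma_star b)"
    using \<epsilon> sigma_row_ge(2)[of b] sigma_col_ge(2)[of b] sigma_star_nonneg[of b]
    by (intro mult_mono r add_left_mono mult_right_mono add_nonneg_nonneg mult_nonneg_nonneg) auto
  also have "\<dots> = (1 + \<epsilon>) * (sigma_row b + sigma_col b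
      + 5 / sqrt (ln (1 + \<epsilon>)) * sigma_star b * sqrt (ln (real CARD('n))))"
    by (simp add: ac_simps)
  finally show ?thesis
    using spectral_norm_majorant_sigma[OF gf refl, of b r] order_trans by blast
qed

lemma nn_integral_le_majorant:
  assumes "integrable M h" "\<And>\<omega>. f \<omega> \<le> h \<omega>" "\<And>\<omega>. 0 \<le> f \<omega>" "(\<integral>\<omega>. h \<omega> \<partial>M) \<le> C"
  shows "(\<integral>\<^sup>+\<omega>. ennreal (f \<omega>) \<partial>M) \<le> ennreal C"
proof -
  have "(\<integral>\<^sup>+\<omega>. ennreal (f \<omega>) \<partial>M) \<le> (\<integral>\<^sup>+\<omega>. ennreal (h \<omega>) \<partial>M)"
    by (intro nn_integral_mono ennreal_leI assms)
  also have "\<dots> = ennreal (\<integral>\<omega>. h \<omega> \<partial>M)"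
    using assms(1) by (intro nn_integral_eq_integral) (auto intro!: AE_I2 order_trans[OF assms(3) assms(2)])
  also have "\<dots> \<le> ennreal C" by (intro ennreal_leI assms)
  finally show ?thesis .
qed

theorem theorem3p1:
  fixes b :: "real^'m::finite^'n::finite"
    and M :: "'a measure"
    and g :: "'n \<Rightarrow> 'm \<Rightarrow> 'a \<Rightarrow> real"
    and \<epsilon> :: real
  assumes "prob_space M"
    and "prob_space.indep_vars M (\<lambda>_. borel) (\<lambda>p. g (fst p) (snd p)) UNIV"
    and "\<And>i j. distributed M lborel (g i j) std_normal_density"
    and "0 < \<epsilon>" and "\<epsilon> \<le> 1/2"
  shows "(\<integral>\<^sup>+\<omega>. ennreal (spectral_norm (\<chi> i j. g i j \<omega> * b $ i $ j)) \<partial>M)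
    \<le> ennreal ((1 + \<epsilon>) * (sigma_row b + sigma_col b
         + 5 / sqrt (ln (1 + \<epsilon>)) * sigma_star b * sqrt (ln (real (min CARD('n) CARD('m))))))"
proof -
  let ?g = "\<lambda>p. g (fst p) (snd p)"
  have gf: "gauss_family M ?g"
    using assms(1-3) by (intro gauss_familyI) auto
  have X: "(\<chi> i j. g i j \<omega> * b $ i $ j) = hadamard b (\<lambda>p. ?g p \<omega>)" for \<omega>
    by (simp add: hadamard_def)
  show ?thesis
  proof (cases "CARD('n) \<le> CARD('m)")
    case True
    obtain h where "integrable M h" "\<And>\<omega>. spectral_norm (hadamard b (\<lambda>p. ?g p \<omega>)) \<le> h \<omega>"
      "(\<integral>\<omega>. h \<omega> \<partial>M) \<le> (1 + \<epsilon>) * (sigma_row b + sigma_col b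
         + 5 / sqrt (ln (1 + \<epsilon>)) * sigma_star b * sqrt (ln (real CARD('n))))"
      using spectral_norm_majorant_rows[OF gf assms(4,5), of b] by blast
    then show ?thesis
      unfolding X using True by (intro nn_integral_le_majorant[of M h]) (simp_all add: spectral_norm_nonneg)
  next
    case False
    \<comment> \<open>With fewer columns than rows the transposed matrix is bounded, so that the
      logarithm involves the smaller dimension; the two sigmas swap and their sum is
      unchanged.\<close>
    have gf': "gauss_family M (\<lambda>e. ?g (prod.swap e))"
      by (rule gauss_family_reindex[OF gf]) simp
    obtain h where h: "integrable M h"
      "\<And>\<omega>. spectral_norm (hadamard (transpose b) (\<lambda>p. ?g (prod.swap p) \<omega>)) \<le> h \<omega>"
      "(\<integral>\<omega>. h \<omega> \<partial>M) \<le> (1 + \<epsilon>) * (sigma_row b + sigma_col b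
         + 5 / sqrt (ln (1 + \<epsilon>)) * sigma_star b * sqrt (ln (real CARD('m))))"
      using spectral_norm_majorant_rows[OF gf' assms(4,5), of "transpose b"]
      by (auto simp: sigma_transpose add.commute)
    have "transpose (hadamard b (\<lambda>p. ?g p \<omega>)) = hadamard (transpose b) (\<lambda>p. ?g (prod.swap p) \<omega>)" for \<omega>
      by (simp add: hadamard_def transpose_def vec_eq_iff)
    then have "spectral_norm (hadamard b (\<lambda>p. ?g p \<omega>)) \<le> h \<omega>" for \<omega>
      using spectral_norm_transpose_le[of "hadamard b (\<lambda>p. ?g p \<omega>)"] h(2)[of \<omega>] by simp
    then show ?thesis
      unfolding X using False h(1,3) by (intro nn_integral_le_majorant[of M h]) (simp_all add: spectral_norm_nonneg)
  qed
qed

end
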